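(* There is an absolute constant $C>0$ such that the following holds. Let $f:\mathbb R_+\to\mathbb C$ be locally absolutely continuous, of bounded variation, such that $\lim_{t\to\infty}f(t)=0$, and such that $f'\in H^1_Q(\mathbb R_+)$. Then for every $x>0$ the sine Fourier transform $\widehat{f_s}(x)=\int_0^\infty f(t)\sin xt\,dt$ satisfies $$\widehat{f_s}(x)=\frac1x f\Big(\frac{\pi}{2x}\Big)+G(x),$$ where $$\|G\|_{L^1(\mathbb R_+)}\le C\,\|f'\|_{H^1_Q(\mathbb R_+)} .$$
   Context: Here $\mathbb R_+=[0,\infty)$. The integral defining $\widehat{f_s}(x)$ is understood as the improper integral $\lim_{A\to\infty}\int_0^A$. For an integrable function $g$ on $\mathbb R_+$, the sine Fourier transform is $\widehat{g_s}(x)=\int_0^\infty g(t)\sin xt\,dt$, and $\mathcal T_g(x)=\widehat{g_s}(x)/x$ for $x>0$. For a function $h$ on $\mathbb R_+$, $$\mathcal H_0h(x)=\frac2\pi\int_0^\infty\frac{t\,h(t)}{t^2-x^2}\,dt,\qquad x>0,$$ with the integral in the principal value sense, i.e. $\lim_{\delta\to0+}\int_{t>0,\,|t-x|>\delta}$. The space $Q_0$ is $$Q_0=\Big\{g:\ g\in L^1(\mathbb R),\ g(-t)=-g(t),\ \int_0^\infty\frac{|\widehat{g_s}(x)|}{x}\,dx<\infty\Big\},$$ and a function on $\mathbb R_+$ is said to belong to $Q_0$ if its odd extension to $\mathbb R$ does. The space $H^1_Q(\mathbb R_+)$ consists of the functions $g\in Q_0$ for which $\mathcal H_0\mathcal T_g$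 is integrable on $\mathbb R_+$, with the norm $$\|g\|_{H^1_Q(\mathbb R_+)}=\|g\|_{L^1(\mathbb R_+)}+\int_0^\infty\frac{|\widehat{g_s}(x)|}{x}\,dx+\|\mathcal H_0\mathcal T_g\|_{L^1(\mathbb R_+)} .$$ *)

theory Defs
  imports "HOL-Analysis.Analysis"
begin

text \<open>
  Functions on the half-line are total functions on the reals whose values at
  negative arguments play no role. Elements of \<open>L\<^sup>1\<close> are represented by
  Lebesgue measurable functions, and the notions below that apply to such elements are invariant
  under changes on null sets.
\<close>

definition absolutely_continuous_on_interval :: "real \<Rightarrow> real \<Rightarrow> (real \<Rightarrow> complex) \<Rightarrow> bool" where
  "absolutely_continuous_on_interval a b f \<longleftrightarrow>
    (\<forall>\<epsilon>>0. \<exists>\<delta>>0. \<forall>(n::nat) (u :: nat \<Rightarrow> real) (v :: nat \<Rightarrow> real).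
       (\<forall>i<n. a \<le> u i \<and> u i \<le> v i \<and> v i \<le> b) \<and>
       disjoint_family_on (\<lambda>i. {u i<..<v i}) {..<n} \<and>
       (\<Sum>i<n. v i - u i) < \<delta>
       \<longrightarrow> (\<Sum>i<n. norm (f (v i) - f (u i))) < \<epsilon>)"

definition locally_absolutely_continuous :: "(real \<Rightarrow> complex) \<Rightarrow> bool" where
  "locally_absolutely_continuous f \<longleftrightarrow>
    (\<forall>a b. 0 \<le> a \<and> a \<le> b \<longrightarrow> absolutely_continuous_on_interval a b f)"

definition bounded_variation_on :: "real set \<Rightarrow> (real \<Rightarrow> complex) \<Rightarrow> bool" where
  "bounded_variation_on S f \<longleftrightarrow>
    (\<exists>V::real. \<forall>(n::nat) (p :: nat \<Rightarrow> real).
       (\<forall>i\<le>n. p i \<in> S) \<and> mono_on {..n} p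
       \<longrightarrow> (\<Sum>i<n. norm (f (p (Suc i)) - f (p i))) \<le> V)"

definition has_improper_sine_transform :: "(real \<Rightarrow> complex) \<Rightarrow> real \<Rightarrow> complex \<Rightarrow> bool" where
  "has_improper_sine_transform f x s \<longleftrightarrow>
    ((\<lambda>A. LINT t:{0..A}|lebesgue. f t * complex_of_real (sin (x * t))) \<longlongrightarrow> s) at_top"

definition sine_transform :: "(real \<Rightarrow> complex) \<Rightarrow> real \<Rightarrow> complex" where
  "sine_transform g x = (LINT t:{0..}|lebesgue. g t * complex_of_real (sin (x * t)))"

definition T_op :: "(real \<Rightarrow> complex) \<Rightarrow> real \<Rightarrow> complex" where
  "T_op g x = sine_transform g x / complex_of_real x"

text \<open>
  The principal value. For \<open>h = T_op g\<close> with \<open>g\<close> in \<open>Q0_half\<close> the truncated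
  integrals converge absolutely and the limit exists for every \<open>x > 0\<close>, since
  the truncated principal value integrals of \<open>sin (t * u) / (t\<^sup>2 - x\<^sup>2)\<close> over \<open>t\<close> are bounded
  uniformly in \<open>u\<close> and \<open>\<delta>\<close>; so \<open>Lim\<close> is not applied to a divergent expression there.
\<close>

definition H0 :: "(real \<Rightarrow> complex) \<Rightarrow> real \<Rightarrow> complex" where
  "H0 h x = complex_of_real (2 / pi) *
     Lim (at_right 0) (\<lambda>\<delta>. LINT t:{t. t > 0 \<and> \<bar>t - x\<bar> > \<delta>}|lebesgue.
                              complex_of_real t * h t / complex_of_real (t\<^sup>2 - x\<^sup>2))"

definition Q0 :: "(real \<Rightarrow> complex) set" where
  "Q0 = {g. integrable lebesgue g \<and>
            (AE t in lebesgue. g (- t) = - g t) \<and>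
            set_integrable lebesgue {0<..} (\<lambda>x. norm (sine_transform g x) / x)}"

definition odd_extension :: "(real \<Rightarrow> complex) \<Rightarrow> real \<Rightarrow> complex" where
  "odd_extension g t = (if t > 0 then g t else if t < 0 then - g (- t) else 0)"

definition Q0_half :: "(real \<Rightarrow> complex) set" where
  "Q0_half = {g. odd_extension g \<in> Q0}"

definition H1Q :: "(real \<Rightarrow> complex) set" where
  "H1Q = {g. g \<in> Q0_half \<and> set_integrable lebesgue {0<..} (H0 (T_op g))}"

definition H1Q_norm :: "(real \<Rightarrow> complex) \<Rightarrow> real" where
  "H1Q_norm g =
     (LINT t:{0..}|lebesgue. norm (g t))
   + (LINT x:{0<..}|lebesgue. norm (sine_transform g x) / x)
   + (LINT x:{0<..}|lebesgue. norm (H0 (T_op g) x))"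

text \<open>
  The derivative of a locally absolutely continuous function exists only almost everywhere,
  so it is determined as a class modulo null sets; \<open>g\<close> is a representative.
\<close>

definition is_ae_derivative :: "(real \<Rightarrow> complex) \<Rightarrow> (real \<Rightarrow> complex) \<Rightarrow> bool" where
  "is_ae_derivative f g \<longleftrightarrow>
    (AE t in lebesgue. t > 0 \<longrightarrow> (f has_vector_derivative g t) (at t))"

end

theory Submission
  imports Defs "HOL-Probability.Sinc_Integral"
begin

text \<open>
  Write \<open>g\<close> for the derivative of \<open>f\<close>. Since \<open>f t\<close> is minus the integral of \<open>g\<close> over \<open>{t..}\<close>, exchanging
  integrals turns the sine transform of \<open>f\<close> into minus the integral of \<open>g u * (1 - cos (x * u)) / x\<close>, so
  that \<open>G x\<close> is the integral of \<open>g u * (cos (x * u) - indicator {..<pi / 2} (x * u)) / x\<close>.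
  On the other hand \<open>H0 (T_op g) x\<close> is the integral of \<open>2 / pi * g u * pv_kernel (x * u) / x\<close>, where
  \<open>pv_kernel s = cos s * Si s - sin s * Ci s\<close>. The difference of the two kernels at \<open>s = x * u\<close>
  is \<open>O(sqrt s)\<close> at \<open>0\<close> and \<open>O(1 / s)\<close> at infinity, hence integrable with
  respect to \<open>ds / s\<close>, and by Tonelli it contributes at most a constant times the \<open>L\<^sup>1\<close> norm of \<open>g\<close>.
\<close>

subsection \<open>The cosine integral\<close>

text \<open>The obstacle is that \<open>cos s / s\<close> fails to be absolutely integrable at both
  ends, so Tonelli alone cannot bound the remainder by the L1 norm of \<open>g\<close>. At 0 the
  indicator helps, since \<open>cos s\<close> is near 1 there. At infinity the oscillation itself
  must be matched: \<open>Si s\<close> tends to \<open>pi / 2\<close> and \<open>Ci s\<close> to 0,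
  so \<open>pv_kernel s\<close> behaves like \<open>pi / 2 * cos s\<close>. The factor
  \<open>2 / pi\<close> in \<open>H0\<close> turns this into \<open>cos s\<close>, which is why the
  norm of \<open>H0 (T_op g)\<close> enters the estimate. The second difficulty is the principal
  value. Its limit stands outside the integral over \<open>t\<close>, yet it has to be taken inside
  an integral over \<open>u\<close>, where nothing converges absolutely at \<delta> = 0. The
  truncated integrals are therefore evaluated in closed form; the contributions singular in \<delta>
  cancel, and what remains is bounded uniformly in \<open>u\<close> and \<delta>. To apply Fubini
  over Borel product spaces, the derivative is replaced by a Borel function \<open>p\<close> that
  vanishes for \<open>u \<le> 0\<close>, so that half-line integrals become integrals over the whole
  line.\<close>

lemma tail_powr:
  fixes w e :: real
  assumes "w > 0" "e < -1"
  shows "set_integrable lborel {w<..} (\<lambda>v. v powr e)"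
    and "(LBINT v:{w<..}. v powr e) = - (w powr (e + 1)) / (e + 1)"
proof -
  have "((\<lambda>v. v powr e) has_integral - (w powr (e + 1)) / (e + 1)) {w<..} \<longleftrightarrow>
      ((\<lambda>v. v powr e) has_integral - (w powr (e + 1)) / (e + 1)) {w..}"
    by (rule has_integral_spike_set_eq; rule negligible_subset[of "{w}"]) auto
  then have hi: "((\<lambda>v. v powr e) has_integral - (w powr (e + 1)) / (e + 1)) {w<..}"
    using has_integral_powr_to_inf[OF assms(2,1)] by simp
  then have a: "(\<lambda>v. v powr e) absolutely_integrable_on {w<..}"
    by (intro nonnegative_absolutely_integrable_1) (auto simp: has_integral_iff)
  have m: "set_borel_measurable borel {w<..} (\<lambda>v. v powr e)"
    unfolding set_borel_measurable_def by measurable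
  show "set_integrable lborel {w<..} (\<lambda>v. v powr e)"
    using a m unfolding set_integrable_def set_borel_measurable_def
    by (subst integrable_completion[symmetric]) auto
  have "(LBINT v:{w<..}. v powr e) = (LINT v:{w<..}|lebesgue. v powr e)"
    using m unfolding set_lebesgue_integral_def set_borel_measurable_def
    by (subst integral_completion) auto
  also have "\<dots> = integral {w<..} (\<lambda>v. v powr e)"
    by (rule set_lebesgue_integral_eq_integral[OF a])
  finally show "(LBINT v:{w<..}. v powr e) = - (w powr (e + 1)) / (e + 1)"
    using hi by (simp add: has_integral_iff)
qed

text \<open>Interpolates between the bounds \<open>z\<close> and 1. The power 1/2 keeps
  \<open>sin v / v\<^sup>2\<close> integrable at infinity and at the same time makes the singularity
  of \<open>Ci\<close> at 0 weaker than \<open>1 / w\<close>.\<close>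

lemma abs_sin_le_sqrt:
  fixes z :: real
  assumes "z \<ge> 0"
  shows "\<bar>sin z\<bar> \<le> sqrt z"
proof (cases "z \<le> 1")
  case True
  then have "z \<le> sqrt z"
    using assms by (intro real_le_rsqrt) (simp add: power2_eq_square mult_left_le)
  then show ?thesis
    using abs_sin_x_le_abs_x[of z] assms by simp
next
  case False
  then show ?thesis
    by (meson abs_sin_le_one linorder_le_cases order_trans real_sqrt_ge_1_iff)
qed

text \<open>
  This is the usual cosine integral, minus the integral of \<open>cos v / v\<close> over \<open>{w<..}\<close>, after one
  integration by parts, which makes the remaining integral absolutely convergent.
\<close>

definition Ci :: "real \<Rightarrow> real" where
  "Ci w = sin w / w - (LBINT v:{w<..}. sin v / v\<^sup>2)"

lemma sin_over_square_bounds: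
  fixes v :: real
  assumes "v > 0"
  shows "\<bar>sin v / v\<^sup>2\<bar> \<le> v powr (-2)" "\<bar>sin v / v\<^sup>2\<bar> \<le> v powr (-3/2)"
proof -
  have v2: "v powr (-2) = 1 / v\<^sup>2"
    using assms by (simp add: powr_minus_divide powr_numeral)
  show "\<bar>sin v / v\<^sup>2\<bar> \<le> v powr (-2)"
    unfolding v2 by (simp add: divide_right_mono)
  have "v powr (-3/2) = v powr (1/2) * v powr (-2)"
    by (simp add: powr_add[symmetric])
  also have "\<dots> = sqrt v / v\<^sup>2"
    using assms by (simp add: v2 powr_half_sqrt)
  finally show "\<bar>sin v / v\<^sup>2\<bar> \<le> v powr (-3/2)"
    using abs_sin_le_sqrt[of v] assms by (simp add: divide_right_mono)
qed

lemma integrable_sin_over_square: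
  fixes w :: real
  assumes "w > 0"
  shows "set_integrable lborel {w<..} (\<lambda>v. sin v / v\<^sup>2)"
proof (rule set_integrable_bound[OF tail_powr(1)[OF assms, of "-2"]])
  show "AE v in lborel. v \<in> {w<..} \<longrightarrow> norm (sin v / v\<^sup>2) \<le> norm (v powr (-2))"
    using assms sin_over_square_bounds(1) by (auto simp del: abs_divide)
qed (auto simp: set_borel_measurable_def)

lemma tail_sin_over_square_bounds:
  fixes w :: real
  assumes "w > 0"
  shows "\<bar>LBINT v:{w<..}. sin v / v\<^sup>2\<bar> \<le> 1 / w"
    and "\<bar>LBINT v:{w<..}. sin v / v\<^sup>2\<bar> \<le> 2 / sqrt w"
proof -
  have *: "\<bar>LBINT v:{w<..}. sin v / v\<^sup>2\<bar> \<le> (LBINT v:{w<..}. v powr e)"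
    if "e < -1" "\<And>v. v > 0 \<Longrightarrow> \<bar>sin v / v\<^sup>2\<bar> \<le> v powr e" for e
  proof -
    have "\<bar>LBINT v:{w<..}. sin v / v\<^sup>2\<bar> \<le> (LBINT v:{w<..}. \<bar>sin v / v\<^sup>2\<bar>)"
      using set_integral_norm_bound[OF integrable_sin_over_square[OF assms]] by simp
    also have "\<dots> \<le> (LBINT v:{w<..}. v powr e)"
      using assms that integrable_sin_over_square[OF assms]
      by (intro set_integral_mono set_integrable_abs tail_powr) auto
    finally show ?thesis .
  qed
  show "\<bar>LBINT v:{w<..}. sin v / v\<^sup>2\<bar> \<le> 1 / w"
    using *[of "-2"] sin_over_square_bounds(1) assms tail_powr(2)[OF assms, of "-2"]
    by (auto simp: powr_minus_divide simp del: abs_divide)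
  have "w powr (-1/2) = 1 / sqrt w"
    using assms by (simp add: powr_minus_divide powr_half_sqrt)
  then show "\<bar>LBINT v:{w<..}. sin v / v\<^sup>2\<bar> \<le> 2 / sqrt w"
    using *[of "-3/2"] sin_over_square_bounds(2) tail_powr(2)[OF assms, of "-3/2"]
    by (auto simp del: abs_divide)
qed

text \<open>The first bound is for large \<open>w\<close>, the second for small \<open>w\<close>.
  The true singularity at 0 is logarithmic; the cruder inverse square root suffices because
  \<open>Ci\<close> is always multiplied by a sine, which is at most a square root.\<close>

lemma Ci_bounds:
  fixes w :: real
  assumes "w > 0"
  shows "\<bar>Ci w\<bar> \<le> 2 / w" "\<bar>Ci w\<bar> \<le> 3 / sqrt w"
proof -
  have "\<bar>sin w / w\<bar> \<le> 1 / w"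
    using assms by (simp add: divide_right_mono)
  then show "\<bar>Ci w\<bar> \<le> 2 / w"
    using tail_sin_over_square_bounds(1)[OF assms] unfolding Ci_def by linarith
  have "\<bar>sin w / w\<bar> \<le> sqrt w / w"
    using abs_sin_le_sqrt[of w] assms by (simp add: divide_right_mono)
  also have "\<dots> = 1 / sqrt w"
    using assms by (simp add: field_simps)
  finally show "\<bar>Ci w\<bar> \<le> 3 / sqrt w"
    using tail_sin_over_square_bounds(2)[OF assms] unfolding Ci_def by linarith
qed

lemma DERIV_Ci:
  fixes w :: real
  assumes "w > 0"
  shows "(Ci has_real_derivative cos w / w) (at w)"
proof -
  \<comment> \<open>A base point strictly between 0 and \<open>w\<close> writes the tail integral as
    a constant minus a proper integral from \<open>a\<close> to \<open>u\<close>, which the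
    fundamental theorem differentiates.\<close>
  define a where "a = w / 2"
  have a: "0 < a" "a < w"
    using assms by (auto simp: a_def)
  let ?f = "\<lambda>v::real. sin v / v\<^sup>2"
  have split: "(LBINT v:{u<..}. ?f v) = (LBINT v:{a<..}. ?f v) - (LBINT v=a..u. ?f v)"
    if "u > a" for u
  proof -
    have "{a<..} = {a<..u} \<union> {u<..}"
      using that by auto
    moreover have "(LBINT v:{a<..u} \<union> {u<..}. ?f v) = (LBINT v:{a<..u}. ?f v) + (LBINT v:{u<..}. ?f v)"
      using that a
      by (intro set_integral_Un set_integrable_subset[OF integrable_sin_over_square[OF a(1)]]
           integrable_sin_over_square) auto
    moreover have "(LBINT v=a..u. ?f v) = (LBINT v:{a<..u}. ?f v)"
      using that by (intro interval_integral_Ioc) auto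
    ultimately show ?thesis
      by simp
  qed
  have "((\<lambda>u. LBINT v=a..u. ?f v) has_vector_derivative ?f w) (at w within {a..2*w})"
    using a by (intro interval_integral_FTC2) (auto intro!: continuous_intros)
  moreover have "(at w within {a..2*w}) = at w"
    using a by (intro at_within_interior) auto
  ultimately have 1: "((\<lambda>u. LBINT v=a..u. ?f v) has_real_derivative ?f w) (at w)"
    by (simp add: has_real_derivative_iff_has_vector_derivative)
  have "((\<lambda>u. sin u / u - ((LBINT v:{a<..}. ?f v) - (LBINT v=a..u. ?f v))) has_real_derivative
      (cos w * w - sin w * 1) / (w * w) - (0 - ?f w)) (at w)"
    using assms by (intro DERIV_diff DERIV_const 1 DERIV_divide DERIV_sin DERIV_ident) auto
  also have "(cos w * w - sin w * 1) / (w * w) - (0 - ?f w) = cos w / w"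
    using assms by (simp add: power2_eq_square field_simps)
  finally show ?thesis
    by (rule has_field_derivative_transform_within_open[of _ _ _ "{a<..}"])
      (use a split in \<open>auto simp: Ci_def\<close>)
qed

subsection \<open>The kernel of the Hilbert transform of a sine transform\<close>

lemma borel_measurable_Ci [measurable]: "Ci \<in> borel_measurable borel"
proof -
  \<comment> \<open>The domain depends on \<open>w\<close>. As a condition on the pair of
    \<open>w\<close> and \<open>v\<close>, the integrand is visibly jointly measurable.\<close>
  have eq: "indicator {w<..} v *\<^sub>R (sin v / v\<^sup>2) = (if w < v then sin v / v\<^sup>2 else 0)" for w v :: real
    by (simp add: indicator_def)
  show ?thesis
    unfolding Ci_def[abs_def] set_lebesgue_integral_def eq by measurable
qed

lemma isCont_Ci: "w > 0 \<Longrightarrow> isCont Ci w"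
  using DERIV_Ci DERIV_isCont by blast

section \<open>Bounds for the sine integral\<close>

lemma abs_Si_le:
  assumes "s \<ge> 0"
  shows "\<bar>Si s\<bar> \<le> s"
proof -
  have sinc: "\<bar>sinc t\<bar> \<le> 1" for t
    using abs_sin_x_le_abs_x[of t] by (simp add: field_simps)
  have "norm (Si s - Si 0) \<le> 1 * norm (s - 0)"
  proof (rule field_differentiable_bound[of UNIV])
    show "(Si has_field_derivative sinc t) (at t within UNIV)" for t
      using DERIV_Si by blast
    show "norm (sinc t) \<le> 1" for t
      using sinc by simp
  qed auto
  then show ?thesis
    using Si_neg[of 0] assms by simp
qed

text \<open>The functions \<open>Si w + cos w / w + c / w\<close> tend to \<open>pi / 2\<close>, and
  their derivative \<open>(- cos w - c) / w\<^sup>2\<close> has constant sign for c = 1 and for c =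
  -1. Monotonicity thus encloses \<open>pi / 2\<close> between their values at \<open>s\<close>; the
  term \<open>cos s / s\<close> costs another \<open>1 / s\<close>.\<close>

lemma abs_Si_minus_pi_half_le:
  assumes "s > 0"
  shows "\<bar>pi / 2 - Si s\<bar> \<le> 2 / s"
proof -
  have der: "((\<lambda>w. Si w + cos w / w + c / w) has_real_derivative (- cos w - c) / w\<^sup>2) (at w)"
    if "w > 0" for w c
    using that by (auto intro!: derivative_eq_intros DERIV_Si simp: power2_eq_square field_simps)
  have "((\<lambda>w::real. cos w / w) \<longlongrightarrow> 0) at_top"
  proof (rule Lim_null_comparison)
    show "\<forall>\<^sub>F w in at_top. norm (cos w / w) \<le> 1 / w"
      using eventually_gt_at_top[of "0::real"] by eventually_elim (simp add: divide_right_mono)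
    show "((\<lambda>w::real. 1 / w) \<longlongrightarrow> 0) at_top"
      by (intro tendsto_divide_0[OF tendsto_const] filterlim_at_top_imp_at_infinity filterlim_ident)
  qed
  moreover have "((\<lambda>w::real. c / w) \<longlongrightarrow> 0) at_top" for c
    by (intro tendsto_divide_0[OF tendsto_const] filterlim_at_top_imp_at_infinity filterlim_ident)
  ultimately have lim: "((\<lambda>w. Si w + cos w / w + c / w) \<longlongrightarrow> pi / 2) at_top" for c
    using tendsto_add[OF tendsto_add[OF Si_at_top]] by fastforce
  have "Si s + cos s / s + 1 / s \<ge> pi / 2"
  proof (rule tendsto_upperbound[OF lim[of 1]])
    show "\<forall>\<^sub>F w in at_top. Si w + cos w / w + 1 / w \<le> Si s + cos s / s + 1 / s"
      using eventually_ge_at_top[of s]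
    proof eventually_elim
      case (elim w)
      show ?case
      proof (rule DERIV_nonpos_imp_nonincreasing[OF elim])
        fix u assume "s \<le> u" "u \<le> w"
        then show "\<exists>y. ((\<lambda>w. Si w + cos w / w + 1 / w) has_real_derivative y) (at u) \<and> y \<le> 0"
          using der[of u 1] assms by (intro exI[of _ "(- cos u - 1) / u\<^sup>2"])
            (auto intro!: divide_nonpos_nonneg simp: add.commute[of _ 1] minus_le_iff)
      qed
    qed
  qed auto
  moreover have "Si s + cos s / s + (-1) / s \<le> pi / 2"
  proof (rule tendsto_lowerbound[OF lim[of "-1"]])
    show "\<forall>\<^sub>F w in at_top. Si s + cos s / s + (-1) / s \<le> Si w + cos w / w + (-1) / w"
      using eventually_ge_at_top[of s]
    proof eventually_elim
      case (elim w)
      show ?case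
      proof (rule DERIV_nonneg_imp_nondecreasing[OF elim])
        fix u assume "s \<le> u" "u \<le> w"
        then show "\<exists>y. ((\<lambda>w. Si w + cos w / w + (-1) / w) has_real_derivative y) (at u) \<and> 0 \<le> y"
          using der[of u "-1"] assms by (intro exI[of _ "(- cos u - (-1)) / u\<^sup>2"]) auto
      qed
    qed
  qed auto
  moreover have "\<bar>cos s / s\<bar> \<le> 1 / s"
    using assms by (simp add: divide_right_mono)
  ultimately show ?thesis
    using assms by (simp only: abs_le_iff minus_divide_left[symmetric]) argo
qed

text \<open>The principal value of the integral of \<open>sin (s * t) / (t\<^sup>2 - 1)\<close> over \<open>t > 0\<close>.\<close>

definition pv_kernel :: "real \<Rightarrow> real" where
  "pv_kernel s = cos s * Si s - sin s * Ci s"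

definition residual_kernel :: "real \<Rightarrow> real" where
  "residual_kernel s = cos s - indicator {..<pi / 2} s - 2 / pi * pv_kernel s"

section \<open>Estimates for the principal value kernel and the residual kernel\<close>

lemma borel_measurable_pv_kernel [measurable]: "pv_kernel \<in> borel_measurable borel"
  unfolding pv_kernel_def[abs_def] by measurable

lemma borel_measurable_residual_kernel [measurable]: "residual_kernel \<in> borel_measurable borel"
  unfolding residual_kernel_def[abs_def] by measurable

lemma residual_kernel_small:
  assumes "0 < s" "s < pi / 2"
  shows "\<bar>residual_kernel s\<bar> \<le> 7 * sqrt s"
proof -
  \<comment> \<open>This is equivalent to \<open>s \<le> 2 * sqrt s\<close>. The linear bounds for
    \<open>1 - cos s\<close> and for \<open>Si s\<close> then cost \<open>2 * sqrt s\<close> each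
    and the \<open>Ci\<close> term \<open>3 * sqrt s\<close>, which explains the 7.\<close>
  have "s \<le> 4" using assms pi_less_4 by simp
  then have s: "s \<le> 2 * sqrt s"
    using assms real_le_rsqrt[of "s / 2" s]
    by (simp add: power2_eq_square)
  have "1 - cos s = 2 * (sin (s / 2))\<^sup>2"
    using cos_double_sin[of "s / 2"] by simp
  also have "(sin (s / 2))\<^sup>2 \<le> \<bar>sin (s / 2)\<bar>"
    by (metis abs_ge_zero abs_sin_le_one mult_left_le power2_abs power2_eq_square)
  also have "\<bar>sin (s / 2)\<bar> \<le> s / 2"
    using abs_sin_x_le_abs_x[of "s / 2"] assms by simp
  finally have "\<bar>cos s - 1\<bar> \<le> s"
    by simp
  moreover have "\<bar>cos s * Si s\<bar> \<le> 1 * s"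
    unfolding abs_mult using assms abs_Si_le[of s] by (intro mult_mono) auto
  moreover have "\<bar>sin s * Ci s\<bar> \<le> s * (3 / sqrt s)"
    unfolding abs_mult using assms Ci_bounds(2)[of s] abs_sin_x_le_abs_x[of s]
    by (intro mult_mono) auto
  moreover have "s * (3 / sqrt s) = 3 * sqrt s"
    using assms by (simp add: field_simps)
  ultimately have 1: "\<bar>cos s - 1\<bar> \<le> 2 * sqrt s" and 2: "\<bar>pv_kernel s\<bar> \<le> 5 * sqrt s"
    using s unfolding pv_kernel_def by linarith+
  have "2 / pi \<le> 1"
    using pi_ge_two by simp
  then have "\<bar>2 / pi * pv_kernel s\<bar> \<le> 1 * (5 * sqrt s)"
    unfolding abs_mult using 2 by (intro mult_mono) auto
  moreover have "indicator {..<pi / 2} s = (1::real)"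
    using assms by simp
  ultimately show ?thesis
    using 1 unfolding residual_kernel_def by linarith
qed

text \<open>The indicator vanishes here, and writing \<open>cos s\<close> as
  \<open>2 / pi * (pi / 2) * cos s\<close> leaves only \<open>pi / 2 - Si s\<close> and
  \<open>Ci s\<close>, each at most \<open>2 / s\<close>.\<close>

lemma residual_kernel_large:
  assumes "s \<ge> pi / 2"
  shows "\<bar>residual_kernel s\<bar> \<le> 4 / s"
proof -
  have s: "s > 0"
    using assms pi_gt_zero by linarith
  have "\<bar>cos s * (pi / 2 - Si s)\<bar> \<le> 1 * (2 / s)"
    unfolding abs_mult using abs_Si_minus_pi_half_le[OF s] by (intro mult_mono) auto
  moreover have "\<bar>sin s * Ci s\<bar> \<le> 1 * (2 / s)"
    unfolding abs_mult using Ci_bounds(1)[OF s] by (intro mult_mono) auto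
  ultimately have "\<bar>cos s * (pi / 2 - Si s) + sin s * Ci s\<bar> \<le> 1 * (2 / s) + 1 * (2 / s)"
    by (intro order_trans[OF abs_triangle_ineq] add_mono)
  then have "\<bar>cos s * (pi / 2 - Si s) + sin s * Ci s\<bar> \<le> 2 / s + 2 / s"
    by simp
  moreover have "\<bar>2 / pi\<bar> \<le> 1"
    using pi_ge_two by simp
  moreover have "residual_kernel s = 2 / pi * (cos s * (pi / 2 - Si s) + sin s * Ci s)"
    using assms unfolding residual_kernel_def pv_kernel_def by (simp add: field_simps)
  then have "\<bar>residual_kernel s\<bar> = \<bar>2 / pi\<bar> * \<bar>cos s * (pi / 2 - Si s) + sin s * Ci s\<bar>"
    by (simp only: abs_mult)
  ultimately have "\<bar>residual_kernel s\<bar> \<le> 1 * (2 / s + 2 / s)"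
    by (simp only:) (intro mult_mono, auto)
  then show ?thesis
    by simp
qed

text \<open>The factor \<open>sin s\<close>, at most \<open>sqrt s\<close>, absorbs the singularity
  \<open>3 / sqrt s\<close> of \<open>Ci\<close>. The constant \<open>B\<close> stands for any bound
  of \<open>Si\<close>.\<close>

lemma abs_pv_kernel_le:
  assumes "\<And>t. \<bar>Si t\<bar> \<le> B" "s > 0"
  shows "\<bar>pv_kernel s\<bar> \<le> B + 3"
proof -
  have "\<bar>cos s * Si s\<bar> \<le> 1 * B"
    unfolding abs_mult using assms by (intro mult_mono) auto
  moreover have "\<bar>sin s * Ci s\<bar> \<le> sqrt s * (3 / sqrt s)"
    unfolding abs_mult using assms by (intro mult_mono abs_sin_le_sqrt Ci_bounds) auto
  moreover have "sqrt s * (3 / sqrt s) = 3"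
    using assms by simp
  ultimately show ?thesis
    unfolding pv_kernel_def by linarith
qed

lemma integrable_residual_kernel:
  "set_integrable lborel {0<..} (\<lambda>s. residual_kernel s / s)"
proof -
  have "((\<lambda>x. x powr (-1/2)) has_integral ((pi/2) powr (-1/2+1) / (-1/2+1))) {0..pi/2}"
    by (rule has_integral_powr_from_0) auto
  then have "(\<lambda>x. x powr (-1/2)) absolutely_integrable_on {0..pi/2}"
    by (intro nonnegative_absolutely_integrable_1) (auto simp: has_integral_iff)
  then have "set_integrable lborel {0..pi/2} (\<lambda>x. x powr (-1/2))"
    unfolding set_integrable_def by (subst integrable_completion[symmetric]) auto
  then have 1: "set_integrable lborel {0<..<pi/2} (\<lambda>x. 7 * x powr (-1/2))"
    by (intro set_integrable_mult_right) (auto elim: set_integrable_subset)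
  have "set_integrable lborel {0<..<pi/2} (\<lambda>s. residual_kernel s / s)"
  proof (rule set_integrable_bound[OF 1])
    have "norm (residual_kernel s / s) \<le> norm (7 * s powr (-1/2))" if "s \<in> {0<..<pi/2}" for s
    proof -
      have "7 * s powr (-1/2) = 7 * (sqrt s / s)"
        using that by (simp add: powr_minus_divide powr_half_sqrt field_simps)
      then show ?thesis
        using residual_kernel_small[of s] that by (simp add: field_simps)
    qed
    then show "AE s in lborel. s \<in> {0<..<pi/2} \<longrightarrow> norm (residual_kernel s / s) \<le> norm (7 * s powr (-1/2))"
      by blast
  qed (auto simp: set_borel_measurable_def)
  moreover have "set_integrable lborel {pi/2..} (\<lambda>s. residual_kernel s / s)"
  proof (rule set_integrable_bound)
    show "set_integrable lborel {pi/2..} (\<lambda>s. 4 * s powr (-2))"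
      by (intro set_integrable_mult_right set_integrable_subset[OF tail_powr(1)[of "1/2" "-2"]])
        (use pi_ge_two in auto)
    have "norm (residual_kernel s / s) \<le> norm (4 * s powr (-2))" if "s \<ge> pi / 2" for s
    proof -
      have s: "s > 0"
        using that pi_gt_zero by linarith
      then have "4 * s powr (-2) = (4 / s) / s"
        by (simp add: powr_minus_divide powr_numeral power2_eq_square)
      then show ?thesis
        using divide_right_mono[OF residual_kernel_large[OF that], of s] s by simp
    qed
    then show "AE s in lborel. s \<in> {pi/2..} \<longrightarrow> norm (residual_kernel s / s) \<le> norm (4 * s powr (-2))"
      by auto
  qed (auto simp: set_borel_measurable_def)
  ultimately have "set_integrable lborel ({0<..<pi/2} \<union> {pi/2..}) (\<lambda>s. residual_kernel s / s)"
    by (intro set_integrable_Un) auto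
  moreover have "{0<..<pi/2} \<union> {pi/2..} = {0<..}"
    using pi_gt_zero by (auto intro: less_le_trans[of 0 "pi/2"])
  ultimately show ?thesis
    by simp
qed

section \<open>Closed form and uniform bound for the truncated principal value integrals\<close>

definition pv_domain :: "real \<Rightarrow> real \<Rightarrow> real set" where
  "pv_domain x \<delta> = {t. t > 0 \<and> \<bar>t - x\<bar> > \<delta>}"

lemma pv_domain_measurable [measurable]: "pv_domain x \<delta> \<in> sets borel"
  unfolding pv_domain_def by measurable

lemma pv_domain_split:
  assumes "0 < \<delta>" "\<delta> < x"
  shows "pv_domain x \<delta> = {0<..<x - \<delta>} \<union> {x + \<delta><..}"
  using assms by (auto simp: pv_domain_def)

lemma integrable_pv_weight:
  assumes "0 < \<delta>" "\<delta> < x"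
  shows "set_integrable lborel (pv_domain x \<delta>) (\<lambda>t. 1 / (t\<^sup>2 - x\<^sup>2))"
proof -
  have "set_integrable lborel {0<..<x - \<delta>} (\<lambda>t. 1 / (t\<^sup>2 - x\<^sup>2))"
  proof (rule set_integrable_subset[of _ "{0..x - \<delta>}"])
    have "t\<^sup>2 - x\<^sup>2 \<noteq> 0" if "t \<in> {0..x - \<delta>}" for t
      using that assms power2_eq_iff_nonneg[of t x] by auto
    then show "set_integrable lborel {0..x - \<delta>} (\<lambda>t. 1 / (t\<^sup>2 - x\<^sup>2))"
      by (intro borel_integrable_atLeastAtMost' continuous_intros) auto
  qed auto
  moreover have "set_integrable lborel {x + \<delta><..} (\<lambda>t. 1 / (t\<^sup>2 - x\<^sup>2))"
  proof (rule set_integrable_bound)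
    \<comment> \<open>The constant comes from
      \<open>t - x \<ge> \<delta> * t / (x + \<delta>)\<close> for
      \<open>t \<ge> x + \<delta>\<close>: multiplied by \<open>t + x \<ge> t\<close>, it bounds
      \<open>t\<^sup>2 - x\<^sup>2\<close> below by a multiple of \<open>t\<^sup>2\<close>.\<close>
    show "set_integrable lborel {x + \<delta><..} (\<lambda>t. (x + \<delta>) / \<delta> * t powr (-2))"
      using assms by (intro set_integrable_mult_right tail_powr) auto
    have "norm (1 / (t\<^sup>2 - x\<^sup>2)) \<le> norm ((x + \<delta>) / \<delta> * t powr (-2))" if "t > x + \<delta>" for t
    proof -
      have t: "t > x" "t > 0"
        using that assms by auto
      have "x * (x + \<delta>) \<le> x * t"
        using that assms by (intro mult_left_mono) auto
      then have *: "t * \<delta> \<le> (x + \<delta>) * (t - x)"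
        by (simp add: algebra_simps)
      define D where "D = t\<^sup>2 - x\<^sup>2"
      have D: "D = (t + x) * (t - x)"
        by (simp add: D_def power2_eq_square algebra_simps)
      then have "D > 0"
        using t assms by simp
      have "t * (t * \<delta>) \<le> (t + x) * ((x + \<delta>) * (t - x))"
        using t assms by (intro mult_mono *) auto
      also have "\<dots> = (x + \<delta>) * D"
        unfolding D by (simp only: mult_ac)
      finally have "1 \<le> (x + \<delta>) * D / (t * (t * \<delta>))"
        using t assms by (subst le_divide_eq_1_pos) auto
      also have "\<dots> = (x + \<delta>) / \<delta> * (1 / t\<^sup>2) * D"
        by (simp add: power2_eq_square)
      finally have "1 / (t\<^sup>2 - x\<^sup>2) \<le> (x + \<delta>) / \<delta> * (1 / t\<^sup>2)"
        using \<open>D > 0\<close> unfolding D_def[symmetric] by (subst pos_divide_le_eq) auto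
      moreover have "0 \<le> 1 / (t\<^sup>2 - x\<^sup>2)"
        using \<open>D > 0\<close> by (simp add: D_def)
      moreover have "t powr (-2) = 1 / t\<^sup>2"
        using t by (simp add: powr_minus_divide powr_numeral)
      ultimately show ?thesis
        using t assms by simp
    qed
    then show "AE t in lborel. t \<in> {x + \<delta><..} \<longrightarrow>
        norm (1 / (t\<^sup>2 - x\<^sup>2)) \<le> norm ((x + \<delta>) / \<delta> * t powr (-2))"
      by auto
  qed (auto simp: set_borel_measurable_def)
  ultimately show ?thesis
    unfolding pv_domain_split[OF assms] by (intro set_integrable_Un) auto
qed

definition truncated_pv :: "real \<Rightarrow> real \<Rightarrow> real \<Rightarrow> real" where
  "truncated_pv x \<delta> u = (LBINT t:pv_domain x \<delta>. sin (u * t) / (t\<^sup>2 - x\<^sup>2))"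

lemma integrable_pv_sin:
  assumes "0 < \<delta>" "\<delta> < x"
  shows "set_integrable lborel (pv_domain x \<delta>) (\<lambda>t. sin (u * t) / (t\<^sup>2 - x\<^sup>2))"
proof (rule set_integrable_bound[OF integrable_pv_weight[OF assms]])
  show "AE t in lborel. t \<in> pv_domain x \<delta> \<longrightarrow> norm (sin (u * t) / (t\<^sup>2 - x\<^sup>2)) \<le> norm (1 / (t\<^sup>2 - x\<^sup>2))"
    by (intro AE_I2) (simp add: divide_right_mono)
qed (auto simp: set_borel_measurable_def)

text \<open>
  Partial fractions, and \<open>u * t = u * (t - x) + u * x = u * (t + x) - u * x\<close> in the numerator. The terms in \<open>Ci\<close> are singular
  at \<open>t = x\<close>, but symmetrically so: they cancel between \<open>x - \<delta>\<close> and \<open>x + \<delta>\<close>.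
\<close>

definition pv_antiderivative :: "real \<Rightarrow> real \<Rightarrow> real \<Rightarrow> real" where
  "pv_antiderivative x u t = (cos (u * x) * (Si (u * (t - x)) - Si (u * (t + x)))
     + sin (u * x) * (Ci (u * \<bar>t - x\<bar>) + Ci (u * (t + x)))) / (2 * x)"

lemma DERIV_pv_antiderivative:
  assumes "x > 0" "u > 0" "t \<ge> 0" "t \<noteq> x"
  shows "(pv_antiderivative x u has_real_derivative sin (u * t) / (t\<^sup>2 - x\<^sup>2)) (at t)"
proof -
  have Si': "((\<lambda>t. Si (u * (t + c))) has_real_derivative sin (u * (t + c)) / (t + c)) (at t)"
    if "t + c \<noteq> 0" for c
  proof -
    have "(Si has_real_derivative sin (u * (t + c)) / (u * (t + c))) (at (u * (t + c)))"
      using DERIV_Si[of "u * (t + c)"] assms that by simp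
    then have "((\<lambda>t. Si (u * (t + c))) has_real_derivative sin (u * (t + c)) / (u * (t + c)) * u) (at t)"
      by (rule DERIV_chain2) (auto intro!: derivative_eq_intros)
    then show ?thesis
      using assms by simp
  qed
  have Ci_lin: "((\<lambda>t. Ci (a * t + b)) has_real_derivative cos (a * t + b) / (a * t + b) * a) (at t)"
    if "a * t + b > 0" for a b
    by (rule DERIV_chain2[where f = Ci and g = "\<lambda>t. a * t + b"])
      (use DERIV_Ci[OF that] in \<open>auto intro!: derivative_eq_intros\<close>)
  have Ci': "((\<lambda>t. Ci (u * (t + x))) has_real_derivative cos (u * (t + x)) / (t + x)) (at t)"
    using Ci_lin[of u "u * x"] assms by (simp add: distrib_left[symmetric] add_pos_nonneg)
  \<comment> \<open>One formula holds on both sides of \<open>x\<close>: to the left the inner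
    derivative contributes a sign, which the odd quotient \<open>cos z / z\<close> absorbs.\<close>
  have Cia: "((\<lambda>t. Ci (u * \<bar>t - x\<bar>)) has_real_derivative cos (u * (t - x)) / (t - x)) (at t)"
  proof (cases "t > x")
    case True
    have "((\<lambda>t. Ci (u * (t - x))) has_real_derivative cos (u * (t - x)) / (t - x)) (at t)"
      using Ci_lin[of u "- (u * x)"] assms True by (simp add: right_diff_distrib[symmetric])
    then show ?thesis
      by (rule has_field_derivative_transform_within_open[of _ _ _ "{x<..}"]) (use True in auto)
  next
    case False
    have "((\<lambda>t. Ci (u * (x - t))) has_real_derivative cos (u * (x - t)) / (u * (x - t)) * (u * -1)) (at t)"
      using Ci_lin[of "- u" "u * x"] assms False by (simp add: right_diff_distrib)
    also have "cos (u * (x - t)) / (u * (x - t)) * (u * -1) = cos (u * (t - x)) / (t - x)"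
      using assms cos_minus[of "u * (t - x)"] by (simp add: field_simps)
    finally show ?thesis
      by (rule has_field_derivative_transform_within_open[of _ _ _ "{..<x}"]) (use False assms in auto)
  qed
  have "(pv_antiderivative x u has_real_derivative
      (cos (u * x) * (sin (u * (t - x)) / (t - x) - sin (u * (t + x)) / (t + x))
     + sin (u * x) * (cos (u * (t - x)) / (t - x) + cos (u * (t + x)) / (t + x))) / (2 * x)) (at t)"
    unfolding pv_antiderivative_def[abs_def]
    using Si'[of "-x"] assms
    by (intro DERIV_cdivide DERIV_add DERIV_cmult DERIV_diff Si' Cia Ci') auto
  also have "cos (u * x) * (sin (u * (t - x)) / (t - x) - sin (u * (t + x)) / (t + x))
     + sin (u * x) * (cos (u * (t - x)) / (t - x) + cos (u * (t + x)) / (t + x))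
     = (sin (u * (t - x)) * cos (u * x) + cos (u * (t - x)) * sin (u * x)) / (t - x)
      - (sin (u * (t + x)) * cos (u * x) - cos (u * (t + x)) * sin (u * x)) / (t + x)"
    by (simp add: add_divide_distrib diff_divide_distrib algebra_simps)
  also have "sin (u * (t - x)) * cos (u * x) + cos (u * (t - x)) * sin (u * x) = sin (u * t)"
    unfolding sin_add[symmetric] by (simp add: algebra_simps)
  also have "sin (u * (t + x)) * cos (u * x) - cos (u * (t + x)) * sin (u * x) = sin (u * t)"
    unfolding sin_diff[symmetric] by (simp add: algebra_simps)
  also have "(sin (u * t) / (t - x) - sin (u * t) / (t + x)) / (2 * x) = sin (u * t) / (t\<^sup>2 - x\<^sup>2)"
  proof -
    have "sin (u * t) / (t - x) - sin (u * t) / (t + x) = sin (u * t) * (2 * x) / ((t - x) * (t + x))"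
      using assms by (simp add: diff_frac_eq algebra_simps)
    also have "(t - x) * (t + x) = t\<^sup>2 - x\<^sup>2"
      by (simp add: power2_eq_square algebra_simps)
    finally show ?thesis
      using assms by simp
  qed
  finally show ?thesis .
qed

lemma tendsto_Ci_at_top: "(Ci \<longlongrightarrow> 0) at_top"
proof (rule Lim_null_comparison)
  show "\<forall>\<^sub>F w in at_top. norm (Ci w) \<le> 2 / w"
    using eventually_gt_at_top[of "0::real"] by eventually_elim (simp add: Ci_bounds)
  show "((\<lambda>w::real. 2 / w) \<longlongrightarrow> 0) at_top"
    by (intro tendsto_divide_0[OF tendsto_const] filterlim_at_top_imp_at_infinity filterlim_ident)
qed

text \<open>Both \<open>Si\<close> terms tend to \<open>pi / 2\<close> and cancel, so the
  antiderivative needs no additive constant to vanish at infinity.\<close>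

lemma tendsto_pv_antiderivative_at_top:
  assumes "x > 0" "u > 0"
  shows "(pv_antiderivative x u \<longlongrightarrow> 0) at_top"
proof -
  have lim: "LIM t at_top. u * (t + c) :> at_top" for c
    using filterlim_tendsto_add_at_top[OF tendsto_const[of c] filterlim_ident] assms
    by (intro filterlim_tendsto_pos_mult_at_top[OF tendsto_const]) (auto simp: add.commute)
  have "((\<lambda>t. (cos (u * x) * (Si (u * (t + (-x))) - Si (u * (t + x)))
     + sin (u * x) * (Ci (u * (t + (-x))) + Ci (u * (t + x)))) / (2 * x)) \<longlongrightarrow>
     (cos (u * x) * (pi / 2 - pi / 2) + sin (u * x) * (0 + 0)) / (2 * x)) at_top"
    using assms
    by (intro tendsto_intros filterlim_compose[OF Si_at_top lim] filterlim_compose[OF tendsto_Ci_at_top lim]) auto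
  then have "((\<lambda>t. (cos (u * x) * (Si (u * (t + (-x))) - Si (u * (t + x)))
     + sin (u * x) * (Ci (u * (t + (-x))) + Ci (u * (t + x)))) / (2 * x)) \<longlongrightarrow> 0) at_top"
    by simp
  then show ?thesis
  proof (rule Lim_transform_eventually)
    show "\<forall>\<^sub>F t in at_top. (cos (u * x) * (Si (u * (t + (-x))) - Si (u * (t + x)))
     + sin (u * x) * (Ci (u * (t + (-x))) + Ci (u * (t + x)))) / (2 * x) = pv_antiderivative x u t"
      using eventually_gt_at_top[of x] by eventually_elim (simp add: pv_antiderivative_def)
  qed
qed

lemma truncated_pv_eq:
  assumes "0 < \<delta>" "\<delta> < x" "u > 0"
  shows "truncated_pv x \<delta> u = pv_antiderivative x u (x - \<delta>) - pv_antiderivative x u 0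
    - pv_antiderivative x u (x + \<delta>)"
proof -
  let ?f = "\<lambda>t. sin (u * t) / (t\<^sup>2 - x\<^sup>2)"
  let ?F = "pv_antiderivative x u"
  have x: "x > 0"
    using assms by simp
  have F: "(?F has_vector_derivative ?f t) (at t)" if "t \<ge> 0" "t \<noteq> x" for t
    using DERIV_pv_antiderivative[OF x assms(3) that]
    by (simp add: has_real_derivative_iff_has_vector_derivative)
  have cont: "isCont ?F t" if "t \<ge> 0" "t \<noteq> x" for t
    using DERIV_pv_antiderivative[OF x assms(3) that] DERIV_isCont by blast
  have f: "isCont ?f t" if "t \<ge> 0" "t \<noteq> x" for t
    using that x power2_eq_iff_nonneg[of t x] by (intro continuous_intros) auto
  have int: "set_integrable lborel {0<..<x - \<delta>} ?f" "set_integrable lborel {x + \<delta><..} ?f"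
    by (rule set_integrable_subset[OF integrable_pv_sin[OF assms(1,2), of u]];
        auto simp: pv_domain_split[OF assms(1,2)])+
  have lim_r: "((?F \<circ> real_of_ereal) \<longlongrightarrow> ?F t) (at_right (ereal t))"
    and lim_l: "((?F \<circ> real_of_ereal) \<longlongrightarrow> ?F t) (at_left (ereal t))" if "t \<ge> 0" "t \<noteq> x" for t
    using cont[OF that] unfolding ereal_tendsto_simps
    by (auto simp: isCont_def intro: filterlim_mono at_le)
  have "(LBINT t=ereal 0..ereal (x - \<delta>). ?f t) = ?F (x - \<delta>) - ?F 0"
    using assms x int(1)
    by (intro interval_integral_FTC_integrable[where F = ?F] F f lim_r lim_l) auto
  moreover have "(LBINT t=ereal (x + \<delta>)..\<infinity>. ?f t) = 0 - ?F (x + \<delta>)"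
    using assms x int(2) tendsto_pv_antiderivative_at_top[OF x assms(3)]
    by (intro interval_integral_FTC_integrable[where F = ?F] F f lim_r)
      (auto simp: ereal_tendsto_simps)
  moreover have "truncated_pv x \<delta> u = (LBINT t:{0<..<x - \<delta>}. ?f t) + (LBINT t:{x + \<delta><..}. ?f t)"
    unfolding truncated_pv_def pv_domain_split[OF assms(1,2)]
    using assms int by (intro set_integral_Un) auto
  ultimately show ?thesis
    using assms by (simp add: interval_integral_to_infinity_eq interval_integral_Ioo)
qed

lemma truncated_pv_formula:
  assumes "0 < \<delta>" "\<delta> < x" "u > 0"
  shows "truncated_pv x \<delta> u =
     (cos (u * x) * (2 * Si (u * x) - 2 * Si (u * \<delta>) + Si (u * (2 * x + \<delta>)) - Si (u * (2 * x - \<delta>)))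
     + sin (u * x) * (Ci (u * (2 * x - \<delta>)) - Ci (u * (2 * x + \<delta>)) - 2 * Ci (u * x))) / (2 * x)"
proof -
  have neg: "Si (u * - \<delta>) = - Si (u * \<delta>)" "Si (u * - x) = - Si (u * x)"
    using assms Si_neg[of "u * \<delta>"] Si_neg[of "u * x"] by simp_all
  have args: "x - \<delta> - x = - \<delta>" "0 - x = - x" "x + \<delta> - x = \<delta>" "\<bar>- \<delta>\<bar> = \<delta>" "\<bar>- x\<bar> = x"
    "\<bar>\<delta>\<bar> = \<delta>" "x - \<delta> + x = 2 * x - \<delta>" "0 + x = x" "x + \<delta> + x = 2 * x + \<delta>"
    using assms by auto
  \<comment> \<open>Here \<open>k\<close> stands for the singular value
    \<open>Ci (u * \<delta>)\<close>. It arises at \<open>x - \<delta>\<close> and at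
    \<open>x + \<delta>\<close> with opposite signs and is absent from the right-hand side.\<close>
  have "c * (- p - q) + s * (k + l) - (c * (- r - r) + s * (m + m)) - (c * (p - n) + s * (k + j))
      = c * (2 * r - 2 * p + n - q) + s * (l - j - 2 * m)" for c p q s k l r m n j :: real
    by (simp add: algebra_simps)
  then show ?thesis
    unfolding truncated_pv_eq[OF assms] pv_antiderivative_def args neg
    by (simp only: diff_divide_distrib[symmetric])
qed

text \<open>After the cancellation every \<open>Ci\<close> has an argument \<open>u * y\<close> with
  \<open>y \<ge> x\<close>, so \<open>\<bar>sin (u * x)\<bar> \<le> sqrt (u * x)\<close> compensates
  \<open>3 / sqrt (u * y)\<close>. The weights of the \<open>Si\<close> terms add up to 6 and those
  of the \<open>Ci\<close> terms to 4, giving \<open>6 * B + 12\<close> before the division by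
  \<open>2 * x\<close>. A bound free of \<open>u\<close> and \<delta> is what dominated convergence
  needs.\<close>

lemma abs_truncated_pv_le:
  assumes "\<And>t. \<bar>Si t\<bar> \<le> B" "0 < \<delta>" "\<delta> < x" "u > 0"
  shows "\<bar>truncated_pv x \<delta> u\<bar> \<le> (3 * B + 6) / x"
proof -
  have x: "x > 0"
    using assms by simp
  have Ci: "\<bar>sin (u * x) * Ci (u * y)\<bar> \<le> 3" if "y \<ge> x" for y
  proof -
    have "\<bar>sin (u * x) * Ci (u * y)\<bar> \<le> sqrt (u * x) * (3 / sqrt (u * y))"
      unfolding abs_mult using that x assms
      by (intro mult_mono abs_sin_le_sqrt Ci_bounds) auto
    also have "\<dots> \<le> sqrt (u * x) * (3 / sqrt (u * x))"
      using that x assms by (intro mult_left_mono divide_left_mono) auto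
    finally show ?thesis
      using x assms by simp
  qed
  have Si: "\<bar>cos (u * x) * Si t\<bar> \<le> B" for t
    using mult_mono[OF abs_cos_le_one[of "u * x"] assms(1)[of t]] by (simp add: abs_mult)
  let ?c = "\<lambda>t. cos (u * x) * Si t" and ?s = "\<lambda>t. sin (u * x) * Ci (u * t)"
  have "truncated_pv x \<delta> u = (2 * ?c (u * x) - 2 * ?c (u * \<delta>) + ?c (u * (2 * x + \<delta>)) - ?c (u * (2 * x - \<delta>))
     + ?s (2 * x - \<delta>) - ?s (2 * x + \<delta>) - 2 * ?s x) / (2 * x)"
    unfolding truncated_pv_formula[OF assms(2-)] by (simp add: algebra_simps)
  moreover have "\<bar>2 * ?c (u * x) - 2 * ?c (u * \<delta>) + ?c (u * (2 * x + \<delta>)) - ?c (u * (2 * x - \<delta>))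
     + ?s (2 * x - \<delta>) - ?s (2 * x + \<delta>) - 2 * ?s x\<bar> \<le> 6 * B + 12"
    using Si[of "u * x"] Si[of "u * \<delta>"] Si[of "u * (2 * x + \<delta>)"] Si[of "u * (2 * x - \<delta>)"]
      Ci[of x] Ci[of "2 * x - \<delta>"] Ci[of "2 * x + \<delta>"] assms
    by (simp only: abs_le_iff) auto
  ultimately show ?thesis
    using x by (simp add: field_simps)
qed

lemma tendsto_truncated_pv:
  assumes "x > 0" "u > 0"
  shows "((\<lambda>\<delta>. truncated_pv x \<delta> u) \<longlongrightarrow> pv_kernel (u * x) / x) (at_right 0)"
proof -
  have Si: "((\<lambda>\<delta>. Si (u * (a * x + b * \<delta>))) \<longlongrightarrow> Si (u * (a * x + b * 0))) (at_right 0)" for a b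
    by (intro isCont_tendsto_compose[OF isCont_Si] tendsto_intros)
  have Ci: "((\<lambda>\<delta>. Ci (u * (2 * x + b * \<delta>))) \<longlongrightarrow> Ci (u * (2 * x + b * 0))) (at_right 0)" for b
    using assms by (intro isCont_tendsto_compose[OF isCont_Ci] tendsto_intros) auto
  have "Si 0 = 0"
    using Si_neg[of 0] by simp
  then have "((\<lambda>\<delta>. (cos (u * x) * (2 * Si (u * x) - 2 * Si (u * \<delta>) + Si (u * (2 * x + \<delta>)) - Si (u * (2 * x - \<delta>)))
     + sin (u * x) * (Ci (u * (2 * x - \<delta>)) - Ci (u * (2 * x + \<delta>)) - 2 * Ci (u * x))) / (2 * x)) \<longlongrightarrow>
     (cos (u * x) * (2 * Si (u * x) - 2 * 0 + Si (u * (2 * x)) - Si (u * (2 * x)))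
     + sin (u * x) * (Ci (u * (2 * x)) - Ci (u * (2 * x)) - 2 * Ci (u * x))) / (2 * x)) (at_right 0)"
    using assms Si[of 0 1] Si[of 2 1] Si[of 2 "-1"] Ci[of 1] Ci[of "-1"]
    by (intro tendsto_intros) auto
  also have "(cos (u * x) * (2 * Si (u * x) - 2 * 0 + Si (u * (2 * x)) - Si (u * (2 * x)))
     + sin (u * x) * (Ci (u * (2 * x)) - Ci (u * (2 * x)) - 2 * Ci (u * x))) / (2 * x) = pv_kernel (u * x) / x"
    using assms by (simp add: pv_kernel_def field_simps)
  finally show ?thesis
  proof (rule Lim_transform_eventually)
    show "\<forall>\<^sub>F \<delta> in at_right 0. (cos (u * x) * (2 * Si (u * x) - 2 * Si (u * \<delta>) + Si (u * (2 * x + \<delta>)) - Si (u * (2 * x - \<delta>)))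
     + sin (u * x) * (Ci (u * (2 * x - \<delta>)) - Ci (u * (2 * x + \<delta>)) - 2 * Ci (u * x))) / (2 * x) = truncated_pv x \<delta> u"
      using eventually_at_right_less[of 0] eventually_at_right_field[of "\<lambda>d. d < x" 0] assms
      by (auto simp: eventually_at_right_field intro!: exI[of _ x] truncated_pv_formula[symmetric])
  qed
qed

section \<open>Exchanging the principal value with the sine transform\<close>

lemma integrable_pair_mult:
  fixes p w :: "real \<Rightarrow> complex"
  assumes [simp]: "integrable lborel p" "integrable lborel w"
  shows "integrable (lborel \<Otimes>\<^sub>M lborel) (\<lambda>(u, t). p u * w t)"
proof (rule lborel_pair.Fubini_integrable)
  have [measurable]: "p \<in> borel_measurable borel" "w \<in> borel_measurable borel"
    using borel_measurable_integrable[OF assms(1)] borel_measurable_integrable[OF assms(2)] by simp_all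
  show "(\<lambda>(u, t). p u * w t) \<in> borel_measurable (lborel \<Otimes>\<^sub>M lborel)"
    by measurable
qed (auto simp: norm_mult)

text \<open>With \<delta> fixed, the double integrand is dominated by \<open>p u\<close> times the
  weight \<open>1 / (t\<^sup>2 - x\<^sup>2)\<close> on the truncated domain, an integrable product.
  Fubini therefore has to come before the limit in \<delta>.\<close>

lemma truncated_H0_integral:
  fixes p :: "real \<Rightarrow> complex"
  assumes p: "integrable lborel p" and \<delta>: "0 < \<delta>" "\<delta> < x"
  shows "(LBINT t:pv_domain x \<delta>. (LBINT u. p u * of_real (sin (t * u))) / of_real (t\<^sup>2 - x\<^sup>2))
    = (LBINT u. p u * of_real (truncated_pv x \<delta> u))"
proof -
  have [measurable]: "p \<in> borel_measurable borel"
    using borel_measurable_integrable[OF p] by simp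
  define w where "w t = (of_real (indicator (pv_domain x \<delta>) t * (1 / (t\<^sup>2 - x\<^sup>2))) :: complex)" for t
  have w: "integrable lborel w"
    unfolding w_def using integrable_pv_weight[OF \<delta>] unfolding set_integrable_def real_scaleR_def
    by (rule integrable_of_real)
  define f where "f = (\<lambda>u t. p u * w t * of_real (sin (u * t)))"
  have "integrable (lborel \<Otimes>\<^sub>M lborel) (\<lambda>(u, t). f u t)"
  proof (rule Bochner_Integration.integrable_bound[OF integrable_pair_mult[OF p w]])
    have [measurable]: "w \<in> borel_measurable borel"
      unfolding w_def by measurable
    show "(\<lambda>(u, t). f u t) \<in> borel_measurable (lborel \<Otimes>\<^sub>M lborel)"
      unfolding f_def by measurable
    show "AE z in lborel \<Otimes>\<^sub>M lborel. norm (case z of (u, t) \<Rightarrow> f u t) \<le> norm (case z of (u, t) \<Rightarrow> p u * w t)"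
      by (intro AE_I2) (auto simp: f_def norm_mult mult_left_le)
  qed
  from lborel_pair.Fubini_integral[OF this]
  have "(LBINT t. LBINT u. f u t) = (LBINT u. LBINT t. f u t)" .
  moreover have "(LBINT u. f u t) =
      indicator (pv_domain x \<delta>) t *\<^sub>R ((LBINT u. p u * of_real (sin (t * u))) / of_real (t\<^sup>2 - x\<^sup>2))" for t
  proof -
    have "(LBINT u. f u t) = (LBINT u. w t * (p u * of_real (sin (t * u))))"
      by (simp add: f_def mult_ac)
    also have "\<dots> = w t * (LBINT u. p u * of_real (sin (t * u)))"
      by (rule integral_mult_right_zero)
    finally show ?thesis
      by (simp add: w_def scaleR_conv_of_real divide_inverse mult_ac)
  qed
  moreover have "(LBINT t. f u t) = p u * of_real (truncated_pv x \<delta> u)" for u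
  proof -
    have "(LBINT t. f u t) =
        (LBINT t. p u * of_real (indicator (pv_domain x \<delta>) t *\<^sub>R (sin (u * t) / (t\<^sup>2 - x\<^sup>2))))"
      by (simp add: f_def w_def mult_ac divide_inverse)
    also have "\<dots> = p u * (LBINT t. of_real (indicator (pv_domain x \<delta>) t *\<^sub>R (sin (u * t) / (t\<^sup>2 - x\<^sup>2))))"
      by (rule integral_mult_right_zero)
    finally show ?thesis
      unfolding truncated_pv_def set_lebesgue_integral_def by (simp only: integral_complex_of_real)
  qed
  ultimately show ?thesis
    by (simp add: set_lebesgue_integral_def)
qed

text \<open>Dominated convergence along sequences in \<open>{0<..<x}\<close>, with a multiple of
  \<open>norm (p u)\<close> as majorant. The closed form covers only \<open>u > 0\<close>; elsewhere
  \<open>p\<close> vanishes.\<close>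

lemma tendsto_truncated_H0_integral:
  fixes p :: "real \<Rightarrow> complex"
  assumes p: "integrable lborel p" and p0: "\<And>u. u \<le> 0 \<Longrightarrow> p u = 0" and x: "x > 0"
  shows "((\<lambda>\<delta>. LBINT u. p u * of_real (truncated_pv x \<delta> u)) \<longlongrightarrow>
    (LBINT u. p u * of_real (pv_kernel (u * x) / x))) (at_right 0)"
proof (rule tendsto_at_right_sequentially[OF x])
  fix d :: "nat \<Rightarrow> real"
  assume d: "\<And>n. 0 < d n" "\<And>n. d n < x" "d \<longlonglongrightarrow> 0"
  have [measurable]: "p \<in> borel_measurable borel"
    using borel_measurable_integrable[OF p] by simp
  have [measurable]: "truncated_pv x \<delta> \<in> borel_measurable borel" for \<delta>
    unfolding truncated_pv_def[abs_def] set_lebesgue_integral_def by measurable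
  obtain B where B: "\<And>t. \<bar>Si t\<bar> \<le> B"
    using bounded_Si by blast
  have dr: "filterlim d (at_right 0) sequentially"
    using d(1,3) less_imp_neq[OF d(1), THEN not_sym] by (auto simp: filterlim_at)
  show "(\<lambda>n. LBINT u. p u * of_real (truncated_pv x (d n) u)) \<longlonglongrightarrow>
      (LBINT u. p u * of_real (pv_kernel (u * x) / x))"
  proof (rule integral_dominated_convergence[where w = "\<lambda>u. norm (p u) * ((3 * B + 6) / x)"])
    show "integrable lborel (\<lambda>u. norm (p u) * ((3 * B + 6) / x))"
      using p by simp
    show "AE u in lborel. (\<lambda>n. p u * of_real (truncated_pv x (d n) u)) \<longlonglongrightarrow> p u * of_real (pv_kernel (u * x) / x)"
    proof (rule AE_I2)
      fix u :: real
      show "(\<lambda>n. p u * of_real (truncated_pv x (d n) u)) \<longlonglongrightarrow> p u * of_real (pv_kernel (u * x) / x)"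
      proof (cases "u > 0")
        case True
        then show ?thesis
          by (intro tendsto_intros filterlim_compose[OF tendsto_truncated_pv[OF x True] dr])
      qed (simp add: p0)
    qed
    show "AE u in lborel. norm (p u * of_real (truncated_pv x (d n) u)) \<le> norm (p u) * ((3 * B + 6) / x)" for n
    proof (rule AE_I2)
      fix u :: real
      show "norm (p u * of_real (truncated_pv x (d n) u)) \<le> norm (p u) * ((3 * B + 6) / x)"
      proof (cases "u > 0")
        case True
        then show ?thesis
          unfolding norm_mult norm_of_real
          by (intro mult_left_mono abs_truncated_pv_le[OF B d(1,2)]) auto
      qed (simp add: p0)
    qed
  qed measurable
qed

lemma H0_sine_transform:
  fixes p :: "real \<Rightarrow> complex"
  assumes p: "integrable lborel p" and p0: "\<And>u. u \<le> 0 \<Longrightarrow> p u = 0" and x: "x > 0"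
    and h: "\<And>t. t > 0 \<Longrightarrow> h t = (LBINT u. p u * of_real (sin (t * u))) / of_real t"
  shows "H0 h x = of_real (2 / pi) * (LBINT u. p u * of_real (pv_kernel (u * x) / x))"
proof -
  let ?I = "\<lambda>\<delta>. LINT t:{t. t > 0 \<and> \<bar>t - x\<bar> > \<delta>}|lebesgue. of_real t * h t / of_real (t\<^sup>2 - x\<^sup>2)"
  let ?S = "\<lambda>t. LBINT u. p u * of_real (sin (t * u))"
  have [measurable]: "p \<in> borel_measurable borel"
    using borel_measurable_integrable[OF p] by simp
  have I: "?I \<delta> = (LBINT u. p u * of_real (truncated_pv x \<delta> u))" if "0 < \<delta>" "\<delta> < x" for \<delta>
  proof -
    \<comment> \<open>All points of the domain are positive, so the factor \<open>t\<close> in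
      \<open>H0\<close> cancels the division by \<open>t\<close> in \<open>h\<close>.\<close>
    have "?I \<delta> = (LINT t:pv_domain x \<delta>|lebesgue. ?S t / of_real (t\<^sup>2 - x\<^sup>2))"
      unfolding set_lebesgue_integral_def pv_domain_def
      by (rule Bochner_Integration.integral_cong) (auto simp: h indicator_def)
    also have "\<dots> = (LBINT t:pv_domain x \<delta>. ?S t / of_real (t\<^sup>2 - x\<^sup>2))"
      unfolding set_lebesgue_integral_def by (rule integral_completion) measurable
    finally show ?thesis
      using truncated_H0_integral[OF p that] by simp
  qed
  have "(?I \<longlongrightarrow> (LBINT u. p u * of_real (pv_kernel (u * x) / x))) (at_right 0)"
    using tendsto_truncated_H0_integral[OF p p0 x]
  proof (rule Lim_transform_eventually)
    show "\<forall>\<^sub>F \<delta> in at_right 0. (LBINT u. p u * of_real (truncated_pv x \<delta> u)) = ?I \<delta>"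
      using x I by (auto simp: eventually_at_right_field intro!: exI[of _ x])
  qed
  then show ?thesis
    unfolding H0_def by (subst tendsto_Lim) auto
qed

subsection \<open>The remainder term\<close>

definition residual_constant :: real where
  "residual_constant = (LBINT s:{0<..}. \<bar>residual_kernel s / s\<bar>)"

text \<open>The measure \<open>dx / x\<close> is invariant under dilations: substituting
  \<open>s = u * x\<close> removes \<open>u\<close> altogether.\<close>

lemma residual_kernel_scaling:
  assumes "u > 0"
  shows "integrable lborel (\<lambda>x. \<bar>indicator {0<..} x * (residual_kernel (u * x) / x)\<bar>)"
    and "(LBINT x. \<bar>indicator {0<..} x * (residual_kernel (u * x) / x)\<bar>) = residual_constant"
proof -
  let ?f = "\<lambda>s. indicator {0<..} s *\<^sub>R \<bar>residual_kernel s / s\<bar>"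
  have int: "integrable lborel ?f"
    using set_integrable_abs[OF integrable_residual_kernel] unfolding set_integrable_def .
  have eq: "u * ?f (0 + u * x) = \<bar>indicator {0<..} x * (residual_kernel (u * x) / x)\<bar>" for x
    using assms by (simp add: indicator_def abs_mult zero_less_mult_iff)
  have "integrable lborel (\<lambda>x. u * ?f (0 + u * x))"
    using assms by (intro integrable_mult_right lborel_integrable_real_affine[OF int]) simp
  then show "integrable lborel (\<lambda>x. \<bar>indicator {0<..} x * (residual_kernel (u * x) / x)\<bar>)"
    unfolding eq .
  have "residual_constant = u * (LBINT x. ?f (0 + u * x))"
    using lborel_integral_real_affine[of u ?f 0] assms
    by (simp add: residual_constant_def set_lebesgue_integral_def)
  also have "\<dots> = (LBINT x. u * ?f (0 + u * x))"
    by (rule integral_mult_right_zero[symmetric])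
  finally show "(LBINT x. \<bar>indicator {0<..} x * (residual_kernel (u * x) / x)\<bar>) = residual_constant"
    unfolding eq by simp
qed

lemma residual_constant_nonneg: "residual_constant \<ge> 0"
  unfolding residual_constant_def set_lebesgue_integral_def
  by (intro Bochner_Integration.integral_nonneg) (simp add: indicator_def)

lemma residual_integral:
  fixes p :: "real \<Rightarrow> complex"
  assumes p: "integrable lborel p" and p0: "\<And>u. u \<le> 0 \<Longrightarrow> p u = 0"
  defines "R \<equiv> \<lambda>x. LBINT u. p u * of_real (residual_kernel (u * x) / x)"
  shows "set_integrable lborel {0<..} R"
    and "(LBINT x:{0<..}. norm (R x)) \<le> residual_constant * (LBINT u. norm (p u))"
proof -
  have [measurable]: "p \<in> borel_measurable borel"
    using borel_measurable_integrable[OF p] by simp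
  define f where "f = (\<lambda>(u, x). p u * of_real (indicator {0<..} x * (residual_kernel (u * x) / x)))"
  \<comment> \<open>Integrating over \<open>x\<close> first is decisive: by scale invariance each
    section contributes the same multiple of \<open>norm (p u)\<close>.\<close>
  have norm_f: "(LBINT x. norm (f (u, x))) = norm (p u) * residual_constant" for u
  proof (cases "u > 0")
    case True
    have "(LBINT x. norm (f (u, x))) =
        (LBINT x. norm (p u) * \<bar>indicator {0<..} x * (residual_kernel (u * x) / x)\<bar>)"
      by (simp only: f_def norm_mult norm_of_real prod.case)
    also have "\<dots> = norm (p u) * residual_constant"
      unfolding residual_kernel_scaling(2)[OF True, symmetric] by (rule integral_mult_right_zero)
    finally show ?thesis .
  qed (simp add: p0 f_def)
  have f: "integrable (lborel \<Otimes>\<^sub>M lborel) f"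
  proof (rule lborel_pair.Fubini_integrable)
    show "f \<in> borel_measurable (lborel \<Otimes>\<^sub>M lborel)"
      unfolding f_def by measurable
    show "integrable lborel (\<lambda>u. LBINT x. norm (f (u, x)))"
      unfolding norm_f using p by simp
    show "AE u in lborel. integrable lborel (\<lambda>x. f (u, x))"
    proof (rule AE_I2)
      fix u
      show "integrable lborel (\<lambda>x. f (u, x))"
      proof (cases "u > 0")
        case True
        have "integrable lborel (\<lambda>x. indicator {0<..} x * (residual_kernel (u * x) / x))"
          using residual_kernel_scaling(1)[OF True] by (subst (asm) integrable_abs_iff) auto
        then show ?thesis
          unfolding f_def by (auto simp del: of_real_mult of_real_divide)
      qed (simp add: p0 f_def)
    qed
  qed
  have R: "indicator {0<..} x *\<^sub>R R x = (LBINT u. f (u, x))" for x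
    by (cases "x > 0") (auto simp: R_def f_def)
  show "set_integrable lborel {0<..} R"
    unfolding set_integrable_def R using lborel_pair.integrable_snd[of "\<lambda>u x. f (u, x)"] f by simp
  have nf: "integrable (lborel \<Otimes>\<^sub>M lborel) (\<lambda>(u, x). norm (f (u, x)))"
    using f by (simp add: case_prod_beta')
  have "(LBINT x:{0<..}. norm (R x)) = (LBINT x. norm (LBINT u. f (u, x)))"
    unfolding set_lebesgue_integral_def R[symmetric] by simp
  also have "\<dots> \<le> (LBINT x. LBINT u. norm (f (u, x)))"
  proof (rule integral_mono)
    show "integrable lborel (\<lambda>x. norm (LBINT u. f (u, x)))"
      using lborel_pair.integrable_snd[of "\<lambda>u x. f (u, x)"] f by simp
    show "integrable lborel (\<lambda>x. LBINT u. norm (f (u, x)))"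
      using lborel_pair.integrable_snd[of "\<lambda>u x. norm (f (u, x))"] nf by simp
  qed (rule integral_norm_bound)
  also have "\<dots> = (LBINT u. LBINT x. norm (f (u, x)))"
    using lborel_pair.Fubini_integral[OF nf] .
  also have "\<dots> = residual_constant * (LBINT u. norm (p u))"
    unfolding norm_f by simp
  finally show "(LBINT x:{0<..}. norm (R x)) \<le> residual_constant * (LBINT u. norm (p u))" .
qed

subsection \<open>The fundamental theorem for absolutely continuous functions\<close>

text \<open>Cells of a partial division have disjoint interiors, so if all lie in \<open>T\<close>
  their total length is at most the measure of \<open>T\<close>. Enumerating them gives a family to
  which the definition of absolute continuity applies.\<close>

lemma absolutely_continuous_tagged_sum:
  fixes f :: "real \<Rightarrow> complex"
  assumes ac: "absolutely_continuous_on_interval a b f" and "e > 0"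
  obtains \<delta> where "\<delta> > 0"
    "\<And>P T. P tagged_partial_division_of {a..b} \<Longrightarrow> T \<in> sets lebesgue \<Longrightarrow> emeasure lebesgue T < ennreal \<delta> \<Longrightarrow>
      (\<And>x K. (x, K) \<in> P \<Longrightarrow> K \<subseteq> T) \<Longrightarrow> (\<Sum>(x, K)\<in>P. norm (f (Sup K) - f (Inf K))) < e"
proof -
  obtain \<delta> where \<delta>: "\<delta> > 0" and ac': "\<forall>(n::nat) u v. (\<forall>i<n. a \<le> u i \<and> u i \<le> v i \<and> v i \<le> b) \<and>
      disjoint_family_on (\<lambda>i. {u i<..<v i}) {..<n} \<and> (\<Sum>i<n. v i - u i) < \<delta>
      \<longrightarrow> (\<Sum>i<n. norm (f (v i) - f (u i))) < e"
    using ac[unfolded absolutely_continuous_on_interval_def, THEN spec, THEN mp, OF \<open>e > 0\<close>]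
    by (elim exE conjE)
  have "(\<Sum>(x, K)\<in>P. norm (f (Sup K) - f (Inf K))) < e"
    if P: "P tagged_partial_division_of {a..b}" and T: "T \<in> sets lebesgue" "emeasure lebesgue T < ennreal \<delta>"
      and PT: "\<And>x K. (x, K) \<in> P \<Longrightarrow> K \<subseteq> T" for P T
  proof -
    note D = tagged_partial_division_ofD[OF P]
    obtain h where h: "bij_betw h {..<card P} P"
      using ex_bij_betw_nat_finite[OF D(1)] by (metis atLeast0LessThan)
    define u where "u = (\<lambda>i. Inf (snd (h i)))"
    define v where "v = (\<lambda>i. Sup (snd (h i)))"
    have interval: "Inf K \<le> Sup K \<and> K = {Inf K..Sup K} \<and> a \<le> Inf K \<and> Sup K \<le> b"
      if xK: "(x, K) \<in> P" for x K
    proof -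
      obtain c d where K: "K = {c..d}"
        using D(4)[OF xK] by auto
      have "c \<le> d"
        using D(2)[OF xK] K by auto
      then show ?thesis
        using D(3)[OF xK] K by auto
    qed
    have hP: "h i \<in> P" if "i < card P" for i
      using h that by (auto simp: bij_betw_def)
    have uv: "u i \<le> v i \<and> snd (h i) = {u i..v i} \<and> a \<le> u i \<and> v i \<le> b" if "i < card P" for i
      using interval[of "fst (h i)" "snd (h i)"] hP[OF that] by (simp add: u_def v_def)
    have disj: "disjoint_family_on (\<lambda>i. {u i<..<v i}) {..<card P}"
    proof (unfold disjoint_family_on_def, intro ballI impI)
      fix i j assume ij: "i \<in> {..<card P}" "j \<in> {..<card P}" "i \<noteq> j"
      then have "h i \<noteq> h j"
        using h by (auto simp: bij_betw_def inj_on_def)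
      then have "interior (snd (h i)) \<inter> interior (snd (h j)) = {}"
        using D(5)[of "fst (h i)" "snd (h i)" "fst (h j)" "snd (h j)"] hP ij by auto
      then show "{u i<..<v i} \<inter> {u j<..<v j} = {}"
        using uv[of i] uv[of j] ij by simp
    qed
    have Tm: "T \<in> lmeasurable"
      using T by (auto simp: fmeasurable_def intro: less_trans)
    have "(\<Sum>i<card P. v i - u i) = (\<Sum>i<card P. measure lebesgue {u i<..<v i})"
      using uv by (intro sum.cong) auto
    also have "\<dots> = measure lebesgue (\<Union>i<card P. {u i<..<v i})"
      using disj uv by (subst measure_finite_Union) auto
    also have "\<dots> \<le> measure lebesgue T"
    proof (rule measure_mono_fmeasurable[OF _ _ Tm])
      show "(\<Union>i<card P. {u i<..<v i}) \<subseteq> T"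
      proof (rule UN_least)
        fix i assume i: "i \<in> {..<card P}"
        then have "snd (h i) \<subseteq> T"
          using hP[of i] PT[of "fst (h i)" "snd (h i)"] by auto
        then show "{u i<..<v i} \<subseteq> T"
          using uv[of i] i by auto
      qed
    qed auto
    also have "\<dots> < \<delta>"
      using T \<delta> Tm by (simp add: emeasure_eq_measure2 ennreal_less_iff)
    finally have "(\<Sum>i<card P. norm (f (v i) - f (u i))) < e"
      using uv disj by (intro ac'[THEN spec, THEN spec, THEN spec, THEN mp]) auto
    also have "(\<Sum>i<card P. norm (f (v i) - f (u i))) = (\<Sum>(x, K)\<in>P. norm (f (Sup K) - f (Inf K)))"
      using sum.reindex_bij_betw[OF h, of "\<lambda>(x, K). norm (f (Sup K) - f (Inf K))"]
      by (simp add: u_def v_def case_prod_beta)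
    finally show ?thesis .
  qed
  then show ?thesis
    using that[OF \<delta>] by blast
qed

text \<open>
  The gauge follows the derivative at tags outside \<open>N\<close>; at tags in \<open>N\<close> it is an open superset of \<open>N\<close>
  of small measure, where absolute continuity makes the increments negligible.
\<close>

lemma absolutely_continuous_has_integral:
  fixes f g :: "real \<Rightarrow> complex"
  assumes ac: "absolutely_continuous_on_interval a b f" and "a \<le> b"
    and N: "negligible N"
    and deriv: "\<And>t. t \<in> {a..b} - N \<Longrightarrow> (f has_vector_derivative g t) (at t)"
  shows "(g has_integral f b - f a) {a..b}"
proof -
  \<comment> \<open>The values of \<open>g\<close> on \<open>N\<close> are arbitrary. With 0 in
    their place, a cell tagged in \<open>N\<close> contributes only an increment of
    \<open>f\<close>.\<close>
  define g0 where "g0 t = (if t \<in> N then 0 else g t)" for t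
  have "(g0 has_integral f b - f a) {a..b}"
    unfolding has_integral_real
  proof (intro allI impI)
    fix e :: real assume "e > 0"
    then have "e / 2 > 0" by simp
    from absolutely_continuous_tagged_sum[OF ac this]
    obtain \<delta> where \<delta>: "\<delta> > 0" and small: "\<And>P T. P tagged_partial_division_of {a..b} \<Longrightarrow>
        T \<in> sets lebesgue \<Longrightarrow> emeasure lebesgue T < ennreal \<delta> \<Longrightarrow>
        (\<And>x K. (x, K) \<in> P \<Longrightarrow> K \<subseteq> T) \<Longrightarrow> (\<Sum>(x, K)\<in>P. norm (f (Sup K) - f (Inf K))) < e / 2"
      by blast
    have N0: "N \<in> null_sets lebesgue"
      using N by (simp add: negligible_iff_null_sets)
    then obtain T where T: "open T" "N \<subseteq> T" "emeasure lebesgue (T - N) < ennreal \<delta>"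
      using sets_lebesgue_outer_open[OF null_setsD2[OF N0] \<delta>] by metis
    then have T': "T \<in> sets lebesgue" "emeasure lebesgue T < ennreal \<delta>"
      using emeasure_Diff_null_set[OF N0, of T] by (simp_all del: emeasure_completion)
    \<comment> \<open>The summand 1 keeps the denominator positive when \<open>a = b\<close> and
      makes the second inequality strict.\<close>
    define \<eta> where "\<eta> = e / (2 * (b - a + 1))"
    have \<eta>: "\<eta> > 0" "\<eta> * (b - a) < e / 2"
      using \<open>e > 0\<close> \<open>a \<le> b\<close> by (simp_all add: \<eta>_def field_simps)
    have "\<forall>x. \<exists>d>0. x \<in> {a..b} - N \<longrightarrow>
        (\<forall>y. norm (y - x) < d \<longrightarrow> norm (f y - f x - (y - x) *\<^sub>R g x) \<le> \<eta> * norm (y - x))"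
    proof
      fix x
      show "\<exists>d>0. x \<in> {a..b} - N \<longrightarrow>
        (\<forall>y. norm (y - x) < d \<longrightarrow> norm (f y - f x - (y - x) *\<^sub>R g x) \<le> \<eta> * norm (y - x))"
      proof (cases "x \<in> {a..b} - N")
        case True
        then show ?thesis
          using deriv[OF True] \<eta>(1) unfolding has_vector_derivative_def has_derivative_within_alt by blast
      qed (auto intro: exI[of _ 1])
    qed
    then obtain d where d: "\<And>x. 0 < d x"
      "\<And>x y. x \<in> {a..b} - N \<Longrightarrow> norm (y - x) < d x \<Longrightarrow> norm (f y - f x - (y - x) *\<^sub>R g x) \<le> \<eta> * norm (y - x)"
      by metis
    define \<gamma> where "\<gamma> x = (if x \<in> N then T else ball x (d x))" for x
    have "gauge \<gamma>"
      using T d(1) by (auto simp: gauge_def \<gamma>_def)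
    moreover have "norm ((\<Sum>(x, K)\<in>D. measure lborel K *\<^sub>R g0 x) - (f b - f a)) < e"
      if D: "D tagged_division_of {a..b}" and fine: "\<gamma> fine D" for D
    proof -
      note DD = tagged_division_ofD[OF D]
      define D1 where "D1 = {z\<in>D. fst z \<in> N}"
      define D2 where "D2 = {z\<in>D. fst z \<notin> N}"
      have fin: "finite D1" "finite D2" and un: "D = D1 \<union> D2" "D1 \<inter> D2 = {}"
        using DD(1) by (auto simp: D1_def D2_def)
      let ?t = "\<lambda>(x, K). measure lborel K *\<^sub>R g0 x - (f (Sup K) - f (Inf K))"
      have ba: "b - a = (\<Sum>(x, K)\<in>D. Sup K - Inf K)" "f b - f a = (\<Sum>(x, K)\<in>D. f (Sup K) - f (Inf K))"
        using additive_tagged_division_1[OF \<open>a \<le> b\<close> D, of "\<lambda>x. x"]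
          additive_tagged_division_1[OF \<open>a \<le> b\<close> D, of f] by auto
      have "(\<Sum>(x, K)\<in>D. measure lborel K *\<^sub>R g0 x) - (f b - f a) = (\<Sum>z\<in>D. ?t z)"
        unfolding ba by (simp add: sum_subtractf case_prod_beta)
      also have "\<dots> = (\<Sum>z\<in>D1. ?t z) + (\<Sum>z\<in>D2. ?t z)"
        unfolding un(1) by (rule sum.union_disjoint[OF fin un(2)])
      finally have "norm ((\<Sum>(x, K)\<in>D. measure lborel K *\<^sub>R g0 x) - (f b - f a))
          \<le> norm (\<Sum>z\<in>D1. ?t z) + norm (\<Sum>z\<in>D2. ?t z)"
        by (simp add: norm_triangle_ineq)
      moreover have "norm (\<Sum>z\<in>D1. ?t z) \<le> (\<Sum>(x, K)\<in>D1. norm (f (Sup K) - f (Inf K)))"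
        by (rule sum_norm_le) (auto simp: D1_def g0_def norm_minus_commute)
      moreover have "\<dots> < e / 2"
      proof (rule small[OF _ T'])
        show "D1 tagged_partial_division_of {a..b}"
          using tagged_partial_division_subset[of D "{a..b}" D1] D
          by (auto simp: D1_def tagged_division_of_def)
        show "K \<subseteq> T" if "(x, K) \<in> D1" for x K
          using fineD[OF fine, of x K] that by (auto simp: D1_def \<gamma>_def)
      qed
      moreover have "norm (\<Sum>z\<in>D2. ?t z) \<le> \<eta> * (b - a)"
      proof -
        have pos: "Inf K \<le> Sup K" if "(x, K) \<in> D" for x K
          using DD(2)[OF that] DD(4)[OF that] by auto
        have "norm (\<Sum>z\<in>D2. ?t z) \<le> (\<Sum>z\<in>D2. \<eta> * (case z of (x, K) \<Rightarrow> Sup K - Inf K))"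
        proof (rule sum_norm_le)
          fix z assume z: "z \<in> D2"
          obtain x K where zxK: "z = (x, K)"
            by (cases z)
          with z have xKD: "(x, K) \<in> D" and x: "x \<notin> N"
            by (auto simp: D2_def)
          obtain u v where K: "K = {u..v}"
            using DD(4)[OF xKD] by auto
          have x_uv: "u \<le> x" "x \<le> v" and x_ab: "x \<in> {a..b} - N"
            using DD(2,3)[OF xKD] K x by auto
          have "K \<subseteq> ball x (d x)"
            using fineD[OF fine xKD] x by (simp add: \<gamma>_def)
          moreover have "u \<in> K" "v \<in> K"
            using K x_uv by auto
          ultimately have "u \<in> ball x (d x)" "v \<in> ball x (d x)"
            by blast+
          then have "norm (u - x) < d x" "norm (v - x) < d x"
            by (auto simp: dist_real_def)
          then have u: "norm (f u - f x - (u - x) *\<^sub>R g x) \<le> \<eta> * (x - u)"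
            and v: "norm (f v - f x - (v - x) *\<^sub>R g x) \<le> \<eta> * (v - x)"
            using d(2)[OF x_ab, of u] d(2)[OF x_ab, of v] x_uv by auto
          \<comment> \<open>The increment over the cell is split at the tag \<open>x\<close>, where
            the derivative is known; the two errors are proportional to \<open>x - u\<close> and
            \<open>v - x\<close>, which add up to the length of the cell.\<close>
          have "measure lborel K *\<^sub>R g0 x - (f (Sup K) - f (Inf K)) =
              (f u - f x - (u - x) *\<^sub>R g x) - (f v - f x - (v - x) *\<^sub>R g x)"
            using K x_uv x by (simp add: g0_def algebra_simps)
          also have "norm \<dots> \<le> \<eta> * (x - u) + \<eta> * (v - x)"
            by (rule order_trans[OF norm_triangle_ineq4 add_mono[OF u v]])
          also have "\<dots> = \<eta> * (Sup K - Inf K)"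
            using K x_uv by (simp add: algebra_simps)
          finally show "norm (?t z) \<le> \<eta> * (case z of (x, K) \<Rightarrow> Sup K - Inf K)"
            by (simp add: zxK)
        qed
        also have "\<dots> = \<eta> * (\<Sum>(x, K)\<in>D2. Sup K - Inf K)"
          by (simp add: sum_distrib_left)
        also have "\<dots> \<le> \<eta> * (\<Sum>(x, K)\<in>D. Sup K - Inf K)"
          using \<eta>(1) DD(1) pos by (intro mult_left_mono sum_mono2) (auto simp: D2_def)
        finally show ?thesis
          unfolding ba .
      qed
      ultimately show ?thesis
        using \<eta>(2) by linarith
    qed
    ultimately show "\<exists>\<gamma>. gauge \<gamma> \<and> (\<forall>D. D tagged_division_of {a..b} \<and> \<gamma> fine D \<longrightarrow>
        norm ((\<Sum>(x, K)\<in>D. measure lborel K *\<^sub>R g0 x) - (f b - f a)) < e)"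
      by (intro exI[of _ \<gamma>]) blast
  qed
  then show ?thesis
    by (rule has_integral_spike[OF N, rotated]) (simp add: g0_def)
qed

subsection \<open>The improper sine transform\<close>

lemma locally_absolutely_continuous_increment:
  fixes f p :: "real \<Rightarrow> complex"
  assumes ac: "locally_absolutely_continuous f" and p: "integrable lborel p"
    and deriv: "AE t in lebesgue. t > 0 \<longrightarrow> (f has_vector_derivative p t) (at t)"
    and ab: "0 \<le> a" "a \<le> b"
  shows "(LBINT u:{a..b}. p u) = f b - f a"
proof -
  obtain N where N: "N \<in> null_sets lebesgue" "\<And>t. t \<notin> N \<Longrightarrow> t > 0 \<Longrightarrow> (f has_vector_derivative p t) (at t)"
    using AE_E3[OF deriv] by auto
  \<comment> \<open>The derivative is given only for \<open>t > 0\<close>, whereas the interval may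
    start at 0.\<close>
  have "negligible (insert 0 N)"
    using N(1) by (simp add: negligible_iff_null_sets[symmetric])
  then have "(p has_integral f b - f a) {a..b}"
  proof (rule absolutely_continuous_has_integral[rotated 2])
    show "absolutely_continuous_on_interval a b f"
      using ac ab by (auto simp: locally_absolutely_continuous_def)
    show "(f has_vector_derivative p t) (at t)" if "t \<in> {a..b} - insert 0 N" for t
      using N(2)[of t] that ab by auto
  qed fact
  moreover have "set_integrable lborel {a..b} p"
    using p unfolding set_integrable_def by (intro integrable_mult_indicator) auto
  ultimately show ?thesis
    using set_borel_integral_eq_integral(2) by (metis integral_unique)
qed

text \<open>Let \<open>b\<close> tend to infinity in the increment formula on \<open>{a..b}\<close>,
  using that \<open>f\<close> vanishes at infinity. The tail is written as an indicator factor so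
  that it can be combined with other kernels under one integral.\<close>

lemma tail_integral_representation:
  fixes f p :: "real \<Rightarrow> complex"
  assumes ac: "locally_absolutely_continuous f" and lim: "(f \<longlongrightarrow> 0) at_top" and p: "integrable lborel p"
    and deriv: "AE t in lebesgue. t > 0 \<longrightarrow> (f has_vector_derivative p t) (at t)"
    and a: "0 \<le> a"
  shows "f a = - (LBINT u. p u * of_real (indicator {a..} u))"
proof -
  have int: "set_integrable lborel {a..} p"
    using p unfolding set_integrable_def by (intro integrable_mult_indicator) auto
  have "((\<lambda>b. LBINT u:{a..b}. p u) \<longlongrightarrow> (LBINT u:{a..}. p u)) at_top"
    by (rule tendsto_set_lebesgue_integral_at_top[OF _ int]) auto
  moreover have "((\<lambda>b. LBINT u:{a..b}. p u) \<longlongrightarrow> 0 - f a) at_top"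
  proof (rule Lim_transform_eventually)
    show "((\<lambda>b. f b - f a) \<longlongrightarrow> 0 - f a) at_top"
      by (intro tendsto_intros lim)
    show "\<forall>\<^sub>F b in at_top. f b - f a = (LBINT u:{a..b}. p u)"
      using eventually_ge_at_top[of a]
      by eventually_elim (simp add: locally_absolutely_continuous_increment[OF ac p deriv a])
  qed
  ultimately have "(LBINT u:{a..}. p u) = 0 - f a"
    by (rule tendsto_unique[rotated]) simp
  moreover have "(LBINT u:{a..}. p u) = (LBINT u. p u * of_real (indicator {a..} u))"
    by (simp add: set_lebesgue_integral_def scaleR_conv_of_real mult.commute)
  ultimately show ?thesis
    by simp
qed

lemma integral_sin_scaled:
  fixes x c :: real
  assumes "x \<noteq> 0" "c \<ge> 0"
  shows "(LBINT t:{0..c}. sin (x * t)) = (1 - cos (x * c)) / x"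
proof -
  have "(LBINT t:{0..c}. sin (x * t)) = (LBINT t. sin (x * t) * indicator {0..c} t)"
    by (simp add: set_lebesgue_integral_def mult.commute)
  also have "\<dots> = - cos (x * c) / x - (- cos (x * 0) / x)"
    using assms
    by (intro integral_FTC_Icc_real) (auto intro!: derivative_eq_intros continuous_intros)
  finally show ?thesis
    using assms by (simp add: diff_divide_distrib)
qed

text \<open>Integration by parts in the guise of Fubini: with the tail representation inserted, the
  condition \<open>t \<le> u\<close> cuts the inner sine integral at \<open>min u A\<close>. The
  cutoff \<open>A\<close> supplies the integrable majorant.\<close>

lemma sine_integral_by_parts:
  fixes f p :: "real \<Rightarrow> complex"
  assumes p: "integrable lborel p" and p0: "\<And>u. u \<le> 0 \<Longrightarrow> p u = 0"
    and f: "\<And>t. t \<ge> 0 \<Longrightarrow> f t = - (LBINT u. p u * of_real (indicator {t..} u))"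
    and x: "x > 0" and A: "A \<ge> 0"
  shows "(LINT t:{0..A}|lebesgue. f t * of_real (sin (x * t)))
    = - (LBINT u. p u * of_real ((1 - cos (x * min u A)) / x))"
proof -
  have [measurable]: "p \<in> borel_measurable borel"
    using borel_measurable_integrable[OF p] by simp
  define F where "F = (\<lambda>u t. p u * of_real (indicator {0..A} t * indicator {(t, u). t \<le> u} (t, u) * sin (x * t)))"
  have w: "integrable lborel (\<lambda>t. of_real (indicator {0..A} t) :: complex)"
    using A by (intro integrable_of_real integrable_real_indicator) auto
  have "integrable (lborel \<Otimes>\<^sub>M lborel) (\<lambda>(u, t). F u t)"
  proof (rule Bochner_Integration.integrable_bound[OF integrable_pair_mult[OF p w]])
    show "(\<lambda>(u, t). F u t) \<in> borel_measurable (lborel \<Otimes>\<^sub>M lborel)"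
      unfolding F_def by measurable
    show "AE z in lborel \<Otimes>\<^sub>M lborel. norm (case z of (u, t) \<Rightarrow> F u t)
        \<le> norm (case z of (u, t) \<Rightarrow> p u * of_real (indicator {0..A} t))"
      by (intro AE_I2) (auto simp: F_def norm_mult mult_left_le indicator_def)
  qed
  from lborel_pair.Fubini_integral[OF this]
  have swap: "(LBINT t. LBINT u. F u t) = (LBINT u. LBINT t. F u t)" .
  have inner_t: "(LBINT t. F u t) = p u * of_real ((1 - cos (x * min u A)) / x)" for u
  proof (cases "u > 0")
    case True
    have "(LBINT t. F u t) = (LBINT t. p u * of_real (indicator {0..min u A} t *\<^sub>R sin (x * t)))"
      by (rule Bochner_Integration.integral_cong) (auto simp: F_def indicator_def)
    also have "\<dots> = p u * (LBINT t. of_real (indicator {0..min u A} t *\<^sub>R sin (x * t)))"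
      by (rule integral_mult_right_zero)
    also have "(LBINT t. of_real (indicator {0..min u A} t *\<^sub>R sin (x * t))) =
        (of_real (LBINT t:{0..min u A}. sin (x * t)) :: complex)"
      unfolding set_lebesgue_integral_def by (rule integral_complex_of_real)
    finally show ?thesis
      using integral_sin_scaled[of x "min u A"] x A True by simp
  qed (simp add: F_def p0)
  have inner_u: "(LBINT u. F u t) = - (indicator {0..A} t *\<^sub>R (f t * of_real (sin (x * t))))" for t
  proof (cases "t \<in> {0..A}")
    case True
    have "(LBINT u. F u t) = (LBINT u. p u * of_real (indicator {t..} u) * of_real (sin (x * t)))"
      using True by (intro Bochner_Integration.integral_cong) (auto simp: F_def indicator_def)
    also have "\<dots> = (LBINT u. p u * of_real (indicator {t..} u)) * of_real (sin (x * t))"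
      by (rule integral_mult_left_zero)
    finally show ?thesis
      using True f[of t] by simp
  qed (simp add: F_def)
  have F_meas: "(\<lambda>t. LBINT u. F u t) \<in> borel_measurable borel"
    unfolding F_def by measurable
  have "(LINT t:{0..A}|lebesgue. f t * of_real (sin (x * t))) = (LINT t|lebesgue. - (LBINT u. F u t))"
    unfolding inner_u set_lebesgue_integral_def by simp
  also have "\<dots> = - (LBINT t. LBINT u. F u t)"
    using F_meas by (subst integral_completion) auto
  finally show ?thesis
    unfolding swap inner_t .
qed

text \<open>For each \<open>u\<close> the integrand is constant once \<open>A \<ge> u\<close>, and
  it is at most \<open>norm (p u) * (2 / x)\<close> for every \<open>A\<close>. The improper
  integral thus exists even where \<open>f\<close> itself is not integrable.\<close>

lemma improper_sine_transform_by_parts: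
  fixes f p :: "real \<Rightarrow> complex"
  assumes p: "integrable lborel p" and p0: "\<And>u. u \<le> 0 \<Longrightarrow> p u = 0"
    and f: "\<And>t. t \<ge> 0 \<Longrightarrow> f t = - (LBINT u. p u * of_real (indicator {t..} u))"
    and x: "x > 0"
  shows "has_improper_sine_transform f x (- (LBINT u. p u * of_real ((1 - cos (x * u)) / x)))"
proof -
  have [measurable]: "p \<in> borel_measurable borel"
    using borel_measurable_integrable[OF p] by simp
  have "((\<lambda>A. LBINT u. p u * of_real ((1 - cos (x * min u A)) / x)) \<longlongrightarrow>
      (LBINT u. p u * of_real ((1 - cos (x * u)) / x))) at_top"
  proof (rule integral_dominated_convergence_at_top[where w = "\<lambda>u. norm (p u) * (2 / x)"])
    show "integrable lborel (\<lambda>u. norm (p u) * (2 / x))"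
      using p by simp
    show "AE u in lborel. ((\<lambda>A. p u * of_real ((1 - cos (x * min u A)) / x)) \<longlongrightarrow>
        p u * of_real ((1 - cos (x * u)) / x)) at_top"
    proof (rule AE_I2)
      fix u
      show "((\<lambda>A. p u * of_real ((1 - cos (x * min u A)) / x)) \<longlongrightarrow>
        p u * of_real ((1 - cos (x * u)) / x)) at_top"
        by (rule tendsto_eventually) (use eventually_ge_at_top[of u] in \<open>eventually_elim, simp\<close>)
    qed
    have "norm (p u * of_real ((1 - cos (x * min u A)) / x)) \<le> norm (p u) * (2 / x)" for u A
    proof -
      have "\<bar>1 - cos (x * min u A)\<bar> \<le> 2"
        using cos_ge_minus_one[of "x * min u A"] by simp
      then have "\<bar>(1 - cos (x * min u A)) / x\<bar> \<le> 2 / x"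
        using x by (simp add: divide_right_mono)
      then show ?thesis
        unfolding norm_mult norm_of_real by (intro mult_left_mono) auto
    qed
    then show "\<forall>\<^sub>F A in at_top. AE u in lborel.
        norm (p u * of_real ((1 - cos (x * min u A)) / x)) \<le> norm (p u) * (2 / x)"
      by (intro always_eventually allI AE_I2)
  qed measurable
  then have "((\<lambda>A. - (LBINT u. p u * of_real ((1 - cos (x * min u A)) / x))) \<longlongrightarrow>
      - (LBINT u. p u * of_real ((1 - cos (x * u)) / x))) at_top"
    by (rule tendsto_minus)
  then show ?thesis
    unfolding has_improper_sine_transform_def
  proof (rule Lim_transform_eventually)
    show "\<forall>\<^sub>F A in at_top. - (LBINT u. p u * of_real ((1 - cos (x * min u A)) / x)) =
        (LINT t:{0..A}|lebesgue. f t * of_real (sin (x * t)))"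
      using eventually_ge_at_top[of 0]
      by eventually_elim (rule sine_integral_by_parts[OF p p0 f x, symmetric])
  qed
qed

subsection \<open>Decomposition of the sine transform\<close>

text \<open>Measurability for the completed measure is traded for Borel measurability in the real
  and the imaginary part separately.\<close>

lemma lebesgue_integrable_borel_representative:
  fixes h :: "'a::euclidean_space \<Rightarrow> complex"
  assumes "integrable lebesgue h"
  obtains q where "integrable lborel q" "AE t in lborel. h t = q t"
proof -
  have m: "h \<in> borel_measurable lebesgue"
    using borel_measurable_integrable[OF assms] .
  obtain r i where r: "r \<in> borel_measurable lborel" "AE t in lborel. Re (h t) = r t"
    and i: "i \<in> borel_measurable lborel" "AE t in lborel. Im (h t) = i t"
    using completion_ex_borel_measurable_real[of "\<lambda>t. Re (h t)" lborel]
      completion_ex_borel_measurable_real[of "\<lambda>t. Im (h t)" lborel] m by auto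
  define q where "q t = Complex (r t) (i t)" for t
  have q: "q \<in> borel_measurable lborel"
    unfolding q_def Complex_eq using r(1) i(1) by measurable
  have ae: "AE t in lborel. h t = q t"
    using r(2) i(2) by eventually_elim (simp add: q_def complex_eq_iff)
  then have "integrable lebesgue q"
    using integrable_cong_AE_imp[OF assms measurable_completion[OF q]] AE_completion[of _ lborel]
    by (metis (mono_tags, lifting) AE_cong)
  then have "integrable lborel q"
    using integrable_completion[OF q] by simp
  then show ?thesis
    using that ae by blast
qed

text \<open>The odd extension agrees with \<open>g\<close> on the positive axis. Cutting its Borel
  version off at 0 makes every half-line integral a full one.\<close>

lemma half_line_representative:
  assumes "g \<in> Q0_half"
  obtains p where "integrable lborel p" "\<And>u. u \<le> 0 \<Longrightarrow> p u = 0"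
    "AE t in lebesgue. t > 0 \<longrightarrow> g t = p t"
proof -
  have "integrable lebesgue (odd_extension g)"
    using assms by (simp add: Q0_half_def Q0_def)
  then obtain q where q: "integrable lborel q" "AE t in lborel. odd_extension g t = q t"
    by (rule lebesgue_integrable_borel_representative)
  show ?thesis
  proof (rule that)
    show "integrable lborel (\<lambda>t. indicator {0<..} t *\<^sub>R q t)"
      using q(1) by (intro integrable_mult_indicator) auto
    have "AE t in lebesgue. odd_extension g t = q t"
      by (rule AE_completion[OF q(2)])
    then show "AE t in lebesgue. t > 0 \<longrightarrow> g t = indicator {0<..} t *\<^sub>R q t"
      by eventually_elim (auto simp: odd_extension_def)
  qed auto
qed

text \<open>The general \<open>k\<close> serves both the sine transform and the L1 norm. The
  condition \<open>k t 0 = 0\<close> removes the negative axis, and the endpoint 0 is a null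
  set.\<close>

lemma half_line_integral_eq:
  fixes g :: "real \<Rightarrow> complex" and k :: "real \<Rightarrow> complex \<Rightarrow> 'b::euclidean_space"
  assumes p: "integrable lborel p" and p0: "\<And>u. u \<le> 0 \<Longrightarrow> p u = 0"
    and gp: "AE t in lebesgue. t > 0 \<longrightarrow> g t = p t"
    and k0: "\<And>t. k t 0 = 0" and k: "(\<lambda>t. k t (p t)) \<in> borel_measurable borel"
  shows "(LINT t:{0..}|lebesgue. k t (g t)) = (LBINT t. k t (p t))"
proof -
  have "AE t in lebesgue. t \<noteq> (0::real)"
    by (rule AE_completion[OF AE_lborel_singleton])
  then have ae: "AE t in lebesgue. k t (p t) = indicator {0..} t *\<^sub>R k t (g t)"
    using gp
  proof eventually_elim
    case (elim t)
    then show ?case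
      by (cases "t > 0") (auto simp: p0 k0)
  qed
  have kp: "(\<lambda>t. k t (p t)) \<in> borel_measurable lebesgue"
    using k by (simp add: measurable_completion)
  have "(LINT t|lebesgue. k t (p t)) = (LINT t|lebesgue. indicator {0..} t *\<^sub>R k t (g t))"
    using ae by (intro integral_cong_AE kp borel_measurable_AE[OF kp ae])
  then show ?thesis
    using k by (simp add: set_lebesgue_integral_def integral_completion)
qed

theorem corollary4:
  shows "\<exists>C::real. C > 0 \<and>
    (\<forall>(f :: real \<Rightarrow> complex) (f' :: real \<Rightarrow> complex).
       locally_absolutely_continuous f \<and>
       bounded_variation_on {0..} f \<and>
       (f \<longlongrightarrow> 0) at_top \<and>
       is_ae_derivative f f' \<and>
       f' \<in> H1Q
       \<longrightarrow>
       (\<exists>G :: real \<Rightarrow> complex.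
          (\<forall>x>0. has_improper_sine_transform f x
                   (complex_of_real (1 / x) * f (pi / (2 * x)) + G x)) \<and>
          set_integrable lebesgue {0<..} G \<and>
          (LINT x:{0<..}|lebesgue. norm (G x)) \<le> C * H1Q_norm f'))"
\<comment> \<open>The 1 pays for the norm of \<open>H0 (T_op f')\<close>, the other summand for the
  L1 norm of \<open>f'\<close>.\<close>
proof (intro exI[of _ "1 + residual_constant"] conjI allI impI)
  show "1 + residual_constant > 0"
    using residual_constant_nonneg by simp
next
  fix f f' :: "real \<Rightarrow> complex"
  assume "locally_absolutely_continuous f \<and> bounded_variation_on {0..} f \<and> (f \<longlongrightarrow> 0) at_top \<and>
    is_ae_derivative f f' \<and> f' \<in> H1Q"
  then have ac: "locally_absolutely_continuous f" and lim: "(f \<longlongrightarrow> 0) at_top"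
    and deriv: "is_ae_derivative f f'" and Q: "f' \<in> Q0_half"
    and H0_int: "set_integrable lebesgue {0<..} (H0 (T_op f'))"
    by (auto simp: H1Q_def)
  obtain p where p: "integrable lborel p" "\<And>u. u \<le> 0 \<Longrightarrow> p u = 0"
    and pf': "AE t in lebesgue. t > 0 \<longrightarrow> f' t = p t"
    using half_line_representative[OF Q] by blast
  have [measurable]: "p \<in> borel_measurable borel"
    using borel_measurable_integrable[OF p(1)] by simp
  have deriv_p: "AE t in lebesgue. t > 0 \<longrightarrow> (f has_vector_derivative p t) (at t)"
    using deriv pf' unfolding is_ae_derivative_def by eventually_elim auto
  have f: "f t = - (LBINT u. p u * of_real (indicator {t..} u))" if "t \<ge> 0" for t
    by (rule tail_integral_representation[OF ac lim p(1) deriv_p that])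
  \<comment> \<open>Since \<open>p\<close> vanishes elsewhere, a bound on \<open>k\<close> for
    \<open>u > 0\<close> is enough. The kernels in question are the cosine, the indicator and
    \<open>pv_kernel\<close>, each divided by \<open>x\<close>.\<close>
  have bounded: "integrable lborel (\<lambda>u. p u * of_real (k u))"
    if "k \<in> borel_measurable borel" "\<And>u. u > 0 \<Longrightarrow> \<bar>k u\<bar> \<le> M" for k M
  proof (rule Bochner_Integration.integrable_bound[where f = "\<lambda>u. of_real M * p u"])
    have "norm (p u * of_real (k u)) \<le> norm (of_real M * p u)" for u
    proof (cases "u > 0")
      case True
      then have "\<bar>k u\<bar> \<le> \<bar>M\<bar>"
        using that(2)[OF True] by simp
      then show ?thesis
        by (simp add: norm_mult mult.commute mult_right_mono)
    qed (simp add: p(2))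
    then show "AE u in lborel. norm (p u * of_real (k u)) \<le> norm (of_real M * p u)"
      by simp
  qed (use p(1) that(1) in auto)
  define R where "R x = (LBINT u. p u * of_real (residual_kernel (u * x) / x))" for x
  \<comment> \<open>Forced by the kernel identity \<open>cos s - indicator {..<pi / 2} s = 2 / pi *
    pv_kernel s + residual_kernel s\<close>.\<close>
  define G where "G x = H0 (T_op f') x + R x" for x
  have H0: "H0 (T_op f') x = of_real (2 / pi) * (LBINT u. p u * of_real (pv_kernel (u * x) / x))" if "x > 0" for x
  proof (rule H0_sine_transform[OF p that])
    show "T_op f' t = (LBINT u. p u * of_real (sin (t * u))) / of_real t" for t
      unfolding T_op_def sine_transform_def
      by (subst half_line_integral_eq[OF p pf', where k = "\<lambda>u z. z * of_real (sin (t * u))"]) auto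
  qed
  have pv_int: "integrable lborel (\<lambda>u. p u * of_real (pv_kernel (u * x) / x))" if x: "x > 0" for x
  proof -
    obtain B where B: "\<And>t. \<bar>Si t\<bar> \<le> B"
      using bounded_Si by blast
    show ?thesis
    proof (rule bounded[where M = "(B + 3) / x"])
      fix u :: real assume "u > 0"
      then show "\<bar>pv_kernel (u * x) / x\<bar> \<le> (B + 3) / x"
        using abs_pv_kernel_le[OF B, of "u * x"] x by (simp add: divide_right_mono)
    qed measurable
  qed
  have "has_improper_sine_transform f x (complex_of_real (1 / x) * f (pi / (2 * x)) + G x)" if x: "x > 0" for x
  proof -
    let ?c = "\<lambda>u. p u * of_real (cos (u * x) / x)" and ?o = "\<lambda>u. p u * of_real (indicator {pi / (2 * x)..} u / x)"
      and ?v = "\<lambda>u. p u * of_real (pv_kernel (u * x) / x)"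
    have c: "integrable lborel ?c" and o: "integrable lborel ?o"
      using x by (auto intro!: bounded[where M = "1 / x"] simp: divide_right_mono indicator_def simp del: of_real_divide)
    have R': "p u * of_real (residual_kernel (u * x) / x) =
        p u * of_real (cos (u * x) / x) - (p u * of_real (1 / x) - ?o u) - of_real (2 / pi) * ?v u" for u
    proof -
      \<comment> \<open>The value \<open>f (pi / (2 * x))\<close> is a tail integral, so the
        indicator is rewritten through its complement, a half-line starting at
        \<open>pi / (2 * x)\<close>.\<close>
      have ind: "indicator {..<pi / 2} (u * x) = 1 - (indicator {pi / (2 * x)..} u :: real)"
        using x by (auto simp: indicator_def field_simps)
      show ?thesis
        unfolding residual_kernel_def ind
          by (simp add: diff_divide_distrib add_divide_distrib algebra_simps)
    qed
    have p1: "integrable lborel (\<lambda>u. p u * of_real (1 / x))"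
      using p(1) by simp
    have "has_bochner_integral lborel (\<lambda>u. ?c u - (p u * of_real (1 / x) - ?o u) - of_real (2 / pi) * ?v u)
        ((LBINT u. ?c u) - ((LBINT u. p u * of_real (1 / x)) - (LBINT u. ?o u)) - of_real (2 / pi) * (LBINT u. ?v u))"
      by (intro has_bochner_integral_diff has_bochner_integral_mult_right has_bochner_integral_integrable
          c o p1 pv_int x)
    then have R: "R x = (LBINT u. ?c u) - ((LBINT u. p u * of_real (1 / x)) - (LBINT u. ?o u))
        - of_real (2 / pi) * (LBINT u. ?v u)"
      unfolding R_def R' by (rule has_bochner_integral_integral_eq)
    have "p u * of_real ((1 - cos (x * u)) / x) = p u * of_real (1 / x) - ?c u" for u
      by (simp add: diff_divide_distrib algebra_simps)
    then have "- (LBINT u. p u * of_real ((1 - cos (x * u)) / x)) = - (LBINT u. p u * of_real (1 / x) - ?c u)"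
      by (simp only:)
    also have "\<dots> = - ((LBINT u. p u * of_real (1 / x)) - (LBINT u. ?c u))"
      by (subst Bochner_Integration.integral_diff[OF p1 c]) simp
    also have "\<dots> = - (LBINT u. ?o u) + (of_real (2 / pi) * (LBINT u. ?v u) + R x)"
      unfolding R by algebra
    also have "(LBINT u. ?o u) = (LBINT u. of_real (1 / x) * (p u * of_real (indicator {pi / (2 * x)..} u)))"
      by (rule Bochner_Integration.integral_cong) simp_all
    also have "\<dots> = of_real (1 / x) * (LBINT u. p u * of_real (indicator {pi / (2 * x)..} u))"
      by (rule integral_mult_right_zero)
    finally have "- (LBINT u. p u * of_real ((1 - cos (x * u)) / x)) = of_real (1 / x) * f (pi / (2 * x)) + G x"
      using f[of "pi / (2 * x)"] x by (simp add: G_def H0[OF x])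
    then show ?thesis
      using improper_sine_transform_by_parts[OF p f x] by simp
  qed
  moreover have R_int: "set_integrable lebesgue {0<..} R"
    using residual_integral(1)[OF p] unfolding set_integrable_def R_def[abs_def]
    by (subst integrable_completion) auto
  then have G_int: "set_integrable lebesgue {0<..} G"
    unfolding G_def[abs_def] using H0_int by (intro set_integral_add)
  moreover have "(LINT x:{0<..}|lebesgue. norm (G x)) \<le> (1 + residual_constant) * H1Q_norm f'"
  proof -
    have "(LINT x:{0<..}|lebesgue. norm (G x)) \<le>
        (LINT x:{0<..}|lebesgue. norm (H0 (T_op f') x) + norm (R x))"
      using G_int H0_int R_int
      by (intro set_integral_mono set_integral_add set_integrable_norm) (auto simp: G_def norm_triangle_ineq)
    also have "\<dots> = (LINT x:{0<..}|lebesgue. norm (H0 (T_op f') x)) + (LINT x:{0<..}|lebesgue. norm (R x))"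
      using H0_int R_int by (intro set_integral_add set_integrable_norm)
    also have "(LINT x:{0<..}|lebesgue. norm (R x)) = (LBINT x:{0<..}. norm (R x))"
      unfolding set_lebesgue_integral_def R_def by (intro integral_completion) measurable
    also have "\<dots> \<le> residual_constant * (LBINT u. norm (p u))"
      unfolding R_def by (rule residual_integral(2)[OF p])
    also have "(LBINT u. norm (p u)) = (LINT t:{0..}|lebesgue. norm (f' t))"
      by (rule half_line_integral_eq[OF p pf', where k = "\<lambda>_ z. norm z", symmetric]) auto
    finally have 1: "(LINT x:{0<..}|lebesgue. norm (G x)) \<le>
        (LINT x:{0<..}|lebesgue. norm (H0 (T_op f') x)) + residual_constant * (LINT t:{0..}|lebesgue. norm (f' t))"
      by simp
    \<comment> \<open>With all three summands of \<open>H1Q_norm\<close> nonnegative, the two that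
      occur in the estimate are each at most the whole norm.\<close>
    have nn: "0 \<le> (LINT t:{0..}|lebesgue. norm (f' t))" "0 \<le> (LINT x:{0<..}|lebesgue. norm (H0 (T_op f') x))"
      "0 \<le> (LINT x:{0<..}|lebesgue. norm (sine_transform f' x) / x)"
      unfolding set_lebesgue_integral_def by (auto intro!: Bochner_Integration.integral_nonneg simp: indicator_def)
    have "(LINT x:{0<..}|lebesgue. norm (H0 (T_op f') x)) \<le> 1 * H1Q_norm f'"
      and "(LINT t:{0..}|lebesgue. norm (f' t)) \<le> H1Q_norm f'"
      using nn by (auto simp: H1Q_norm_def)
    then show ?thesis
      using 1 mult_left_mono[OF _ residual_constant_nonneg] unfolding distrib_right by fastforce
  qed
  ultimately show "\<exists>G :: real \<Rightarrow> complex.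
          (\<forall>x>0. has_improper_sine_transform f x
                   (complex_of_real (1 / x) * f (pi / (2 * x)) + G x)) \<and>
          set_integrable lebesgue {0<..} G \<and>
          (LINT x:{0<..}|lebesgue. norm (G x)) \<le> (1 + residual_constant) * H1Q_norm f'"
    by blast
qed

end
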